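(* Let $q\neq0$ be real. (a) For $\eta\in\mathbb C[S_0(n)]$, $$T(\eta)=W(e^{\mathcal L}\eta)=\sum_{\ell=0}^\infty\frac1{\ell!}W(\mathcal L^\ell(\eta))=\sum_{\pi\in\mathcal P_{1,2}(n)}W(C_\pi(\eta)).$$ (b) For $\alpha\in S_0(n)$, $\beta\in S_0(k)$, $$W(\alpha)W(\beta)=W(\alpha\cup\beta)+\sum_{\ell=1}^{\min(n,k)}\frac1{\ell!}W\big(\mathcal L_{n,k}^{(\ell)}(\alpha\cup\beta)\big)=\sum_{\pi\in\mathcal P_{1,2}(n,k)}W\big(C_\pi(\alpha\cup\beta)\big).$$
   Context: Permutations. $[n]=\{1,\dots,n\}$, $[0,n]=\{0,\dots,n\}$; $S(n)$, $S_0(n)$ are the permutation groups of $[n]$, $[0,n]$, with $S(n)\subset S_0(n)$ the permutations fixing $0$; products are composed right to left. $\mathrm{cyc}_0(\alpha)$ is the number of cycles of $\alpha\in S_0(n)$ (fixed points are cycles) not containing $0$. For $\alpha\in S_0(n)$, $\beta\in S_0(k)$, $\alpha\cup\beta=\beta'\alpha\in S_0(n+k)$, where $\alpha$ is extended by fixing $n+1,\dots,n+k$, and $\beta'$ fixes $[n]$ and is obtained from $\beta$ by replacing each $j\in[k]$ by $n+j$ ($0$ unchanged). Contractions. $\mathcal P_{1,2}(n)$ is the set of partitions $\pi$ of $[n]$ into blocks of size 1 and 2, identified with the involution swapping the elements of each pair; $|\pi|$ is the number of pairs, $\mathrm{supp}(\pi)$ the union of the pairs. $\mathcal P_{1,2}(n,k)$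 is the set of $\pi\in\mathcal P_{1,2}(n+k)$ such that every pair $\{i<j\}$ of $\pi$ satisfies $i\le n<j$. For $S\subset[n]$, $\alpha|_{S^c}$ is the permutation of $[0,n]\setminus S$, $x\mapsto\alpha^m(x)$, $m=\min\{j>0:\alpha^j(x)\notin S\}$. For $\ell=|\pi|$, $$C_\pi(\alpha)=q^{\mathrm{cyc}_0((\pi\alpha)|_{\mathrm{supp}(\pi)^c})-\mathrm{cyc}_0(\pi\alpha)+\ell}\;P\big((\pi\alpha)|_{\mathrm{supp}(\pi)^c}\big)\in\mathbb C[S_0(n-2\ell)],$$ where $P$ relabels $[0,n]\setminus\mathrm{supp}(\pi)$ by $[0,n-2\ell]$ in the order-preserving way; extend linearly. For a transposition $\tau=(ij)\in S(n)$, $C_\tau$ is $C_\pi$ for $\pi$ with the single pair $\{i,j\}$. $\mathcal L$ acts on $\mathbb C[S_0(n)]$ as $\sum_{\tau\text{ a transposition in }S(n)}C_\tau$, with values in $\mathbb C[S_0(n-2)]$. $\mathcal L^{(\ell)}_{n,k}=\ell!\sum_{\pi\in\mathcal P_{1,2}(n,k),|\pi|=\ell}C_\pi$. Algebra. The vector space $\bigoplus_{n\ge0}\mathbb C[S_0(n)]$, with the element corresponding to $\eta$ denoted $T(\eta)$, is given the bilinear multiplication $T(\alpha)T(\beta)=T(\alpha\cup\beta)$ for $\alpha\in S_0(n)$, $\beta\in S_0(k)$. For $\eta\in\mathbb C[S_0(n)]$ the Wick product is $$W(\eta)=T(e^{-\mathcal L}\eta)=\sum_{\ell\ge0}\frac{(-1)^\ell}{\ell!}T(\mathcal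 L^\ell(\eta))=\sum_{\pi\in\mathcal P_{1,2}(n)}(-1)^{|\pi|}T(C_\pi(\eta)),$$ extended linearly to the direct sum. *)

theory Defs
  imports Complex_Main "HOL-Library.Poly_Mapping" "HOL-Library.Disjoint_Sets"
    "HOL-Combinatorics.Permutations" "HOL-Combinatorics.Orbits"
begin

section \<open>Permutations\<close>

text \<open>An element of S_0(n) is a function with \<open>\<alpha> permutes {0..n}\<close>; more generally, a permutation
  of a finite set X is a function with \<open>\<alpha> permutes X\<close>. As such a function does not determine X,
  the carrier is passed separately where it matters.\<close>

definition cyc0 :: "nat set \<Rightarrow> (nat \<Rightarrow> nat) \<Rightarrow> nat" where
  "cyc0 X \<alpha> = card {orbit \<alpha> x | x. x \<in> X \<and> 0 \<notin> orbit \<alpha> x}"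

definition perm_union :: "nat \<Rightarrow> nat \<Rightarrow> (nat \<Rightarrow> nat) \<Rightarrow> (nat \<Rightarrow> nat) \<Rightarrow> nat \<Rightarrow> nat" where
  "perm_union n k \<alpha> \<beta> = map_permutation {0..k} (\<lambda>j. if j = 0 then 0 else n + j) \<beta> \<circ> \<alpha>"

text \<open>The permutation induced by \<open>\<alpha>\<close> on the complement of S, extended by the identity on S.\<close>

definition induced_perm :: "nat set \<Rightarrow> (nat \<Rightarrow> nat) \<Rightarrow> nat \<Rightarrow> nat" where
  "induced_perm S \<alpha> x =
     (if x \<in> S then x else (\<alpha> ^^ (LEAST j. 0 < j \<and> (\<alpha> ^^ j) x \<notin> S)) x)"

text \<open>On a finite set X, \<open>\<lambda>x. card {y \<in> X. y < x}\<close> is the order-preserving bijection from X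
  to an initial segment of the natural numbers.\<close>

definition relabel :: "nat set \<Rightarrow> (nat \<Rightarrow> nat) \<Rightarrow> nat \<Rightarrow> nat" where
  "relabel X \<alpha> = map_permutation X (\<lambda>x. card {y \<in> X. y < x}) \<alpha>"


section \<open>Partitions into blocks of size one and two\<close>

definition P12 :: "nat \<Rightarrow> nat set set set" where
  "P12 n = {\<pi>. partition_on {1..n} \<pi> \<and> (\<forall>B\<in>\<pi>. card B = 1 \<or> card B = 2)}"

definition pairs :: "nat set set \<Rightarrow> nat set set" where
  "pairs \<pi> = {B \<in> \<pi>. card B = 2}"

definition supp :: "nat set set \<Rightarrow> nat set" where
  "supp \<pi> = \<Union> (pairs \<pi>)"

definition involution :: "nat set set \<Rightarrow> nat \<Rightarrow> nat" where
  "involution \<pi> x = (if x \<in> supp \<pi> then (THE y. {x, y} \<in> pairs \<pi>) else x)"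

definition P12_between :: "nat \<Rightarrow> nat \<Rightarrow> nat set set set" where
  "P12_between n k = {\<pi> \<in> P12 (n + k). \<forall>i j. {i, j} \<in> pairs \<pi> \<and> i < j \<longrightarrow> i \<le> n \<and> n < j}"

definition transpositions :: "nat \<Rightarrow> (nat \<Rightarrow> nat) set" where
  "transpositions n = {transpose i j | i j. i \<in> {1..n} \<and> j \<in> {1..n} \<and> i \<noteq> j}"

text \<open>The partition of [n] whose blocks are the cycles of an involution \<open>\<tau>\<close>.\<close>

definition cycle_partition :: "nat \<Rightarrow> (nat \<Rightarrow> nat) \<Rightarrow> nat set set" where
  "cycle_partition n \<tau> = (\<lambda>x. {x, \<tau> x}) ` {1..n}"


section \<open>The direct sum of the group algebras\<close>

text \<open>The direct sum over n of the spaces C[S_0(n)] has as a basis the pairs \<open>(n, \<alpha>)\<close> with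
  \<open>\<alpha> \<in> S_0(n)\<close>. The type below also has basis vectors \<open>(n, \<alpha>)\<close> for other \<open>\<alpha>\<close>; the subspace
  C[S_0(n)] is singled out by \<open>group_alg n\<close>.\<close>

type_synonym palg = "(nat \<times> (nat \<Rightarrow> nat)) \<Rightarrow>\<^sub>0 complex"

definition group_alg :: "nat \<Rightarrow> palg set" where
  "group_alg n = {\<eta>. Poly_Mapping.keys \<eta> \<subseteq> {n} \<times> {\<alpha>. \<alpha> permutes {0..n}}}"

definition basis_elt :: "nat \<Rightarrow> (nat \<Rightarrow> nat) \<Rightarrow> palg" where
  "basis_elt n \<alpha> = Poly_Mapping.single (n, \<alpha>) 1"

definition scale :: "complex \<Rightarrow> ('b \<Rightarrow>\<^sub>0 complex) \<Rightarrow> ('b \<Rightarrow>\<^sub>0 complex)" where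
  "scale c x = Poly_Mapping.map (\<lambda>a. c * a) x"

definition lin_ext :: "('b \<Rightarrow> ('c \<Rightarrow>\<^sub>0 complex)) \<Rightarrow> ('b \<Rightarrow>\<^sub>0 complex) \<Rightarrow> ('c \<Rightarrow>\<^sub>0 complex)" where
  "lin_ext f x = (\<Sum>b\<in>Poly_Mapping.keys x. scale (Poly_Mapping.lookup x b) (f b))"


section \<open>Contractions\<close>

text \<open>The exponent of q can be negative, whence \<open>powi\<close>.\<close>

definition contraction_basis :: "real \<Rightarrow> nat set set \<Rightarrow> nat \<Rightarrow> (nat \<Rightarrow> nat) \<Rightarrow> palg" where
  "contraction_basis q \<pi> n \<alpha> =
     (let l = card (pairs \<pi>);
          \<sigma> = involution \<pi> \<circ> \<alpha>;
          X = {0..n} - supp \<pi>;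
          \<rho> = induced_perm (supp \<pi>) \<sigma>
      in scale (complex_of_real q powi (int (cyc0 X \<rho>) - int (cyc0 {0..n} \<sigma>) + int l))
           (basis_elt (n - 2 * l) (relabel X \<rho>)))"

definition contraction :: "real \<Rightarrow> nat set set \<Rightarrow> palg \<Rightarrow> palg" where
  "contraction q \<pi> = lin_ext (\<lambda>(n, \<alpha>). contraction_basis q \<pi> n \<alpha>)"

definition lap :: "real \<Rightarrow> palg \<Rightarrow> palg" where
  "lap q = lin_ext (\<lambda>(n, \<alpha>).
     \<Sum>\<tau>\<in>transpositions n. contraction q (cycle_partition n \<tau>) (basis_elt n \<alpha>))"

definition lap_between :: "real \<Rightarrow> nat \<Rightarrow> nat \<Rightarrow> nat \<Rightarrow> palg \<Rightarrow> palg" where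
  "lap_between q l n k \<eta> =
     scale (fact l) (\<Sum>\<pi> | \<pi> \<in> P12_between n k \<and> card (pairs \<pi>) = l. contraction q \<pi> \<eta>)"

text \<open>\<open>Sum_any\<close> is the sum of a family with finite support (and 0 if the support is infinite).
  The support is always finite here, because each application of \<open>lap q\<close> lowers the degree by two.\<close>

lemma lap_degree:
  assumes "\<forall>b\<in>Poly_Mapping.keys x. fst b \<le> N"
  shows "\<forall>b\<in>Poly_Mapping.keys (lap q x). fst b < N"
proof
  have keys_scale: "Poly_Mapping.keys (scale c y) \<subseteq> Poly_Mapping.keys y"
    for c :: complex and y :: palg
    unfolding scale_def by (auto simp: in_keys_iff map.rep_eq)
  fix b assume "b \<in> Poly_Mapping.keys (lap q x)"
  then obtain n \<alpha> where "(n, \<alpha>) \<in> Poly_Mapping.keys x"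
    and "b \<in> Poly_Mapping.keys
      (\<Sum>\<tau>\<in>transpositions n. contraction q (cycle_partition n \<tau>) (basis_elt n \<alpha>))"
    unfolding lap_def lin_ext_def using keys_sum keys_scale by fastforce
  moreover then obtain \<tau> where \<tau>: "\<tau> \<in> transpositions n"
    and "b \<in> Poly_Mapping.keys (contraction q (cycle_partition n \<tau>) (basis_elt n \<alpha>))"
    using keys_sum by fastforce
  moreover then have "b \<in> Poly_Mapping.keys (contraction_basis q (cycle_partition n \<tau>) n \<alpha>)"
    unfolding contraction_def lin_ext_def basis_elt_def using keys_scale by fastforce
  moreover then have "fst b = n - 2 * card (pairs (cycle_partition n \<tau>))"
    unfolding contraction_basis_def Let_def basis_elt_def using keys_scale by fastforce
  moreover have "0 < card (pairs (cycle_partition n \<tau>)) \<and> 0 < n"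
  proof -
    obtain i j where ij: "i \<in> {1..n}" "j \<in> {1..n}" "i \<noteq> j" "\<tau> = transpose i j"
      using \<tau> unfolding transpositions_def by blast
    then have "{i, \<tau> i} \<in> pairs (cycle_partition n \<tau>)"
      unfolding pairs_def cycle_partition_def by auto
    moreover have "finite (pairs (cycle_partition n \<tau>))"
      unfolding pairs_def cycle_partition_def by simp
    ultimately show ?thesis using ij(1) card_gt_0_iff by fastforce
  qed
  ultimately show "fst b < N" using assms by fastforce
qed

lemma finite_lap_powers: "finite {l. (lap q ^^ l) x \<noteq> 0}"
proof -
  obtain N where N: "\<forall>b\<in>Poly_Mapping.keys x. fst b < N"
    using finite_nat_set_iff_bounded[of "fst ` Poly_Mapping.keys x"] by auto
  have *: "\<forall>b\<in>Poly_Mapping.keys ((lap q ^^ l) x). fst b + l < N" for l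
  proof (induction l)
    case 0 then show ?case using N by simp
  next
    case (Suc l)
    have "\<forall>b\<in>Poly_Mapping.keys ((lap q ^^ l) x). fst b \<le> N - Suc l"
      using Suc by fastforce
    from lap_degree[OF this] show ?case by fastforce
  qed
  have "(lap q ^^ l) x = 0" if "N \<le> l" for l
  proof -
    have "Poly_Mapping.keys ((lap q ^^ l) x) = {}" using *[of l] that by fastforce
    then show ?thesis by simp
  qed
  then have "{l. (lap q ^^ l) x \<noteq> 0} \<subseteq> {..<N}" by (metis (mono_tags) linorder_not_le lessThan_iff mem_Collect_eq subsetI)
  then show ?thesis using finite_subset by blast
qed

text \<open>The exponential of \<open>t * lap q\<close>.\<close>

definition exp_lap :: "real \<Rightarrow> complex \<Rightarrow> palg \<Rightarrow> palg" where
  "exp_lap q t x = Sum_any (\<lambda>l. scale (t ^ l / fact l) ((lap q ^^ l) x))"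


section \<open>The algebra and the Wick product\<close>

text \<open>The underlying vector space of the algebra is the direct sum itself, so the identification
  T of the direct sum with the algebra is the identity map.\<close>

definition algT :: "palg \<Rightarrow> palg" where
  "algT \<eta> = \<eta>"

definition alg_mult :: "palg \<Rightarrow> palg \<Rightarrow> palg" (infixl "\<star>" 70) where
  "x \<star> y = lin_ext (\<lambda>(n, \<alpha>). lin_ext (\<lambda>(k, \<beta>).
     algT (basis_elt (n + k) (perm_union n k \<alpha> \<beta>))) y) x"

definition wick :: "real \<Rightarrow> palg \<Rightarrow> palg" where
  "wick q \<eta> = algT (exp_lap q (-1) \<eta>)"

end

theory Submission
  imports Defs
begin

text \<open>Everything rests on one fact: contractions compose. If M and N are disjoint sets of disjoint
  pairs, then contracting along M and afterwards along N, relabelled to the points that M leaves over,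
  is the contraction along \<open>M \<union> N\<close> (\<open>contraction_contraction\<close>). On permutations this holds because
  the involution of N fixes the points removed by M, so it can be pulled out of the first-return map
  to their complement, and because iterated first returns are first returns. For the powers of q,
  the exponent is rewritten as the number of pairs minus the number of cycles lying entirely inside
  the removed set; these cycles are not affected by N, and the counts for M and for N add up.

  Since a partition into blocks of size one and two is determined by its set of pairs, all sums
  run over matchings. By composition, an operator acting on basis vectors as the sum of
  \<open>c (card M)\<close> times the contraction along M, over all matchings M, may be handled like the
  exponential generating function of its coefficients c: operators compose by binomial convolution
  (\<open>contraction_series_compose\<close>). The Laplacian has the coefficients of t, so its l-th power has
  those of \<open>t ^ l\<close>, its exponentials have the coefficients \<open>1\<close> and \<open>(-1) ^ k\<close>, and the
  exponentials are mutually inverse. This is part (a).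

  For part (b), contractions of \<open>\<alpha>\<close> and of \<open>\<beta>\<close> multiply to the contraction of \<open>\<alpha> \<union> \<beta>\<close> along the
  juxtaposed matching (\<open>contraction_star\<close>), because the two permutations share only the point 0,
  which is never removed. So the left-hand side is the signed sum of contractions over the matchings
  of [n+k] without a pair that crosses from [n] to its complement (\<open>wick_star_wick\<close>). On the
  right-hand side, every matching \<open>\<Theta>\<close> arises by first choosing some of its crossing pairs, and the
  signs cancel unless \<open>\<Theta>\<close> has no crossing pair (\<open>sum_wick_contraction\<close>).\<close>

section \<open>Linear maps between free vector spaces\<close>

lemma lookup_scale [simp]: "Poly_Mapping.lookup (scale c x) b = c * Poly_Mapping.lookup x b"
  by (simp add: scale_def map.rep_eq when_def)

interpretation free: module "scale :: complex \<Rightarrow> ('b \<Rightarrow>\<^sub>0 complex) \<Rightarrow> ('b \<Rightarrow>\<^sub>0 complex)"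
  by unfold_locales (auto intro!: poly_mapping_eqI simp: lookup_add algebra_simps)

abbreviation linear_op :: "(('b \<Rightarrow>\<^sub>0 complex) \<Rightarrow> ('c \<Rightarrow>\<^sub>0 complex)) \<Rightarrow> bool" where
  "linear_op \<equiv> module_hom scale scale"

lemma linear_opI:
  assumes "\<And>x y. F (x + y) = F x + F y" "\<And>c x. F (scale c x) = scale c (F x)"
  shows "linear_op F"
  by unfold_locales (use assms in auto)

lemma lin_ext_superset:
  assumes "finite K" "Poly_Mapping.keys x \<subseteq> K"
  shows "lin_ext f x = (\<Sum>b\<in>K. scale (Poly_Mapping.lookup x b) (f b))"
  unfolding lin_ext_def using assms
  by (intro sum.mono_neutral_left) (auto simp: in_keys_iff)

lemma linear_lin_ext: "linear_op (lin_ext f)"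
proof (rule linear_opI)
  fix x y :: "'a \<Rightarrow>\<^sub>0 complex" and c
  let ?K = "Poly_Mapping.keys x \<union> Poly_Mapping.keys y"
  show "lin_ext f (x + y) = lin_ext f x + lin_ext f y"
    using Poly_Mapping.keys_add[of x y]
    by (simp add: lin_ext_superset[of ?K] lookup_add free.scale_left_distrib sum.distrib)
  have "Poly_Mapping.keys (scale c x) \<subseteq> Poly_Mapping.keys x"
    by (auto simp: in_keys_iff)
  then show "lin_ext f (scale c x) = scale c (lin_ext f x)"
    by (simp add: lin_ext_superset[of "Poly_Mapping.keys x"] free.scale_sum_right)
qed

lemma lin_ext_single [simp]: "lin_ext f (Poly_Mapping.single b 1) = f b"
  by (simp add: lin_ext_def)

lemma decompose_basis:
  "x = (\<Sum>b\<in>Poly_Mapping.keys x. scale (Poly_Mapping.lookup x b) (Poly_Mapping.single b 1))"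
proof (rule poly_mapping_eqI)
  fix a
  show "Poly_Mapping.lookup x a = Poly_Mapping.lookup (\<Sum>b\<in>Poly_Mapping.keys x.
      scale (Poly_Mapping.lookup x b) (Poly_Mapping.single b 1)) a"
    by (simp add: lookup_sum lookup_single when_def in_keys_iff
        if_distrib[of "\<lambda>z. _ * z"] cong: if_cong)
qed

text \<open>Only the basis vectors in the support are compared, so that identities valid on
  C[S_0(n)] alone can be extended from permutations to this subspace.\<close>

lemma linear_eqI:
  assumes "linear_op F" "linear_op G"
    and "\<And>b. b \<in> Poly_Mapping.keys x \<Longrightarrow> F (Poly_Mapping.single b 1) = G (Poly_Mapping.single b 1)"
  shows "F x = G x"
proof -
  have *: "H x = (\<Sum>b\<in>Poly_Mapping.keys x. scale (Poly_Mapping.lookup x b) (H (Poly_Mapping.single b 1)))"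
    if "linear_op H" for H :: "('a \<Rightarrow>\<^sub>0 complex) \<Rightarrow> ('b \<Rightarrow>\<^sub>0 complex)"
    by (subst decompose_basis[of x]) (simp add: module_hom.sum[OF that] module_hom.scale[OF that])
  show ?thesis using assms by (simp add: *)
qed

lemma linear_op_scale: "linear_op F \<Longrightarrow> linear_op (\<lambda>x. scale c (F x))"
  by (rule linear_opI)
    (simp_all add: module_hom.add module_hom.scale free.scale_right_distrib mult.commute)

lemma linear_op_sum:
  assumes "\<And>i. i \<in> I \<Longrightarrow> linear_op (F i)"
  shows "linear_op (\<lambda>x. \<Sum>i\<in>I. F i x)"
proof (rule linear_opI)
  fix x y c
  have "F i (x + y) = F i x + F i y" "F i (scale c x) = scale c (F i x)" if "i \<in> I" for i
    using module_hom.add[OF assms[OF that]] module_hom.scale[OF assms[OF that]] by auto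
  then show "(\<Sum>i\<in>I. F i (x + y)) = (\<Sum>i\<in>I. F i x) + (\<Sum>i\<in>I. F i y)"
    and "(\<Sum>i\<in>I. F i (scale c x)) = scale c (\<Sum>i\<in>I. F i x)"
    by (simp_all add: sum.distrib free.scale_sum_right)
qed

lemma linear_op_compose: "linear_op F \<Longrightarrow> linear_op G \<Longrightarrow> linear_op (\<lambda>x. G (F x))"
  by (rule linear_opI) (simp_all add: module_hom.add module_hom.scale)

lemma linear_contraction: "linear_op (contraction q \<pi>)"
  unfolding contraction_def by (rule linear_lin_ext)

lemma linear_lap: "linear_op (lap q)"
  unfolding lap_def by (rule linear_lin_ext)

lemma linear_lap_power: "linear_op (lap q ^^ l)"
  by (induction l) (auto intro: linear_opI simp: module_hom.add[OF linear_lap] 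
      module_hom.scale[OF linear_lap] module_hom.add module_hom.scale)

text \<open>The index set is left flexible because linearity of the exponential needs a common one
  for several vectors.\<close>

lemma exp_lap_eq_sum:
  assumes "finite K" "{l. (lap q ^^ l) x \<noteq> 0} \<subseteq> K"
  shows "exp_lap q t x = (\<Sum>l\<in>K. scale (t ^ l / fact l) ((lap q ^^ l) x))"
proof -
  have "{l. scale (t ^ l / fact l) ((lap q ^^ l) x) \<noteq> 0} \<subseteq> K" using assms(2) by auto
  then show ?thesis unfolding exp_lap_def by (rule Sum_any.expand_superset[OF assms(1)])
qed

lemma linear_exp_lap: "linear_op (exp_lap q t)"
proof (rule linear_opI)
  fix x y :: palg and c
  let ?K = "{l. (lap q ^^ l) x \<noteq> 0} \<union> {l. (lap q ^^ l) y \<noteq> 0}"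
  have fin: "finite ?K" using finite_lap_powers by blast
  note lin = module_hom.add[OF linear_lap_power] module_hom.scale[OF linear_lap_power]
  have "exp_lap q t z = (\<Sum>l\<in>?K. scale (t ^ l / fact l) ((lap q ^^ l) z))"
    if "z \<in> {x, y, x + y, scale c x}" for z
    by (rule exp_lap_eq_sum[OF fin]) (use that in \<open>auto simp: lin\<close>)
  then show "exp_lap q t (x + y) = exp_lap q t x + exp_lap q t y"
    and "exp_lap q t (scale c x) = scale c (exp_lap q t x)"
    by (simp_all add: lin free.scale_right_distrib sum.distrib free.scale_sum_right mult.commute)
qed

lemma linear_wick: "linear_op (wick q)"
  using linear_exp_lap[of q "-1"] unfolding wick_def algT_def by simp

lemma linear_star_left: "linear_op (\<lambda>x. x \<star> y)"
  unfolding alg_mult_def by (rule linear_lin_ext)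

lemma linear_star_right: "linear_op (\<lambda>y. x \<star> y)"
  unfolding alg_mult_def lin_ext_def[of _ x]
  by (intro linear_op_sum linear_op_scale) (auto intro: linear_lin_ext)

lemma star_basis: "basis_elt n \<alpha> \<star> basis_elt k \<beta> = basis_elt (n + k) (perm_union n k \<alpha> \<beta>)"
  by (simp add: alg_mult_def basis_elt_def algT_def)


section \<open>First returns\<close>

text \<open>The first point of a forward orbit outside S, as an inductive relation: its rule
  induction replaces arithmetic with the minimal exponent that defines the induced
  permutation.\<close>

inductive first_return :: "nat set \<Rightarrow> (nat \<Rightarrow> nat) \<Rightarrow> nat \<Rightarrow> nat \<Rightarrow> bool" for S f where
  direct: "f x \<notin> S \<Longrightarrow> first_return S f x (f x)"
| detour: "f x \<in> S \<Longrightarrow> first_return S f (f x) y \<Longrightarrow> first_return S f x y"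

lemma first_return_notin: "first_return S f x y \<Longrightarrow> y \<notin> S"
  by (induction rule: first_return.induct) auto

lemma first_return_orbit: "first_return S f x y \<Longrightarrow> y \<in> orbit f x"
  by (induction rule: first_return.induct) (auto intro: orbit.base orbit_subset)

lemma first_return_eq_funpow:
  "first_return S f x y \<Longrightarrow> (f ^^ (LEAST j. 0 < j \<and> (f ^^ j) x \<notin> S)) x = y"
proof (induction rule: first_return.induct)
  case (direct x)
  then have "(LEAST j. 0 < j \<and> (f ^^ j) x \<notin> S) = 1"
    by (intro Least_equality) auto
  then show ?case by simp
next
  case (detour x y)
  let ?P = "\<lambda>j. 0 < j \<and> (f ^^ j) x \<notin> S" and ?Q = "\<lambda>j. 0 < j \<and> (f ^^ j) (f x) \<notin> S"
  have PQ: "?P (Suc j) \<longleftrightarrow> ?Q j" for j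
    using detour(1) by (cases j) (simp_all add: funpow_swap1)
  have "y \<notin> S" "y \<in> orbit f (f x)"
    using detour(2) by (auto dest: first_return_notin first_return_orbit)
  then obtain n where "?P (Suc n)" unfolding PQ by (auto simp: orbit_altdef)
  then have "(LEAST j. ?P j) = Suc (LEAST j. ?P (Suc j))"
    by (rule Least_Suc) simp
  then have "(LEAST j. ?P j) = Suc (LEAST j. ?Q j)" unfolding PQ .
  then show ?case using detour(3) by (simp add: funpow_swap1)
qed

lemma induced_perm_eqI: "first_return S f x y \<Longrightarrow> x \<notin> S \<Longrightarrow> induced_perm S f x = y"
  by (simp add: induced_perm_def first_return_eq_funpow)

text \<open>Existence needs only some point of the orbit outside S; for a permutation of a finite
  set, the starting point itself recurs.\<close>

lemma first_return_exists:
  assumes "y \<in> orbit f x" "y \<notin> S"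
  shows "\<exists>z. first_return S f x z"
proof -
  obtain n where "(f ^^ Suc n) x \<notin> S"
    using assms by (auto simp: orbit_altdef gr0_conv_Suc)
  then show ?thesis
  proof (induction n arbitrary: x)
    case 0 then show ?case by (auto intro: first_return.direct)
  next
    case (Suc n)
    then show ?case
      by (cases "f x \<in> S") (auto simp: funpow_swap1 intro: first_return.intros)
  qed
qed

lemma first_return_induced_perm:
  assumes "f permutes Z" "finite Z" "x \<notin> S"
  shows "first_return S f x (induced_perm S f x)"
proof -
  have "x \<in> orbit f x"
    using assms by (intro permutation_self_in_orbit) (auto simp: permutation_permutes)
  then show ?thesis using first_return_exists induced_perm_eqI assms(3) by metis
qed

lemma induced_perm_in [simp]: "x \<in> S \<Longrightarrow> induced_perm S f x = x"
  by (simp add: induced_perm_def)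

lemma first_return_comp_left:
  assumes "first_return S f x y" "\<And>z. z \<in> S \<Longrightarrow> g z = z" "inj g"
  shows "first_return S (g \<circ> f) x (g y)"
  using assms(1)
proof (induction rule: first_return.induct)
  case (direct x)
  then have "g (f x) \<notin> S"
    using assms(2)[of "g (f x)"] injD[OF assms(3), of "g (f x)" "f x"] by auto
  then show ?case using first_return.direct[of "g \<circ> f" x S] by (simp add: o_def)
next
  case (detour x y)
  then show ?case using assms(2) first_return.detour[of "g \<circ> f" x S] by (simp add: o_def)
qed

text \<open>A path towards its first return only meets points that g fixes, so g acts once, on the
  endpoint; as g preserves the complement of S, the path does not leave S at another time.\<close>

lemma induced_perm_comp_left:
  assumes f: "f permutes Z" "finite Z" and g: "g permutes Y" "Y \<inter> S = {}"
  shows "induced_perm S (g \<circ> f) = g \<circ> induced_perm S f"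
proof
  fix x
  have fixed: "g z = z" if "z \<in> S" for z
    using g that by (meson disjoint_iff permutes_not_in)
  show "induced_perm S (g \<circ> f) x = (g \<circ> induced_perm S f) x"
  proof (cases "x \<in> S")
    case False
    have "first_return S (g \<circ> f) x (g (induced_perm S f x))"
      using first_return_induced_perm[OF f False] fixed permutes_inj[OF g(1)]
      by (rule first_return_comp_left)
    then show ?thesis using induced_perm_eqI False by simp
  qed (simp add: fixed)
qed

lemma first_return_comp_right:
  assumes "first_return S f x y" "\<And>z. z \<in> S \<Longrightarrow> g z = z"
  shows "g w = x \<Longrightarrow> first_return S (f \<circ> g) w y"
  using assms(1)
proof (induction arbitrary: w rule: first_return.induct)
  case (direct x)
  then show ?case using first_return.direct[of "f \<circ> g" w S] by (simp add: o_def)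
next
  case (detour x y)
  then show ?case using assms(2) first_return.detour[of "f \<circ> g" w S] by (simp add: o_def)
qed

text \<open>Here g acts only on the starting point of the path.\<close>

lemma induced_perm_comp_right:
  assumes f: "f permutes Z" "finite Z" and g: "g permutes Y" "Y \<inter> S = {}"
  shows "induced_perm S (f \<circ> g) = induced_perm S f \<circ> g"
proof
  fix x
  have fixed: "g z = z" if "z \<in> S" for z
    using g that by (meson disjoint_iff permutes_not_in)
  show "induced_perm S (f \<circ> g) x = (induced_perm S f \<circ> g) x"
  proof (cases "x \<in> S")
    case False
    then have "g x \<notin> S"
      using fixed[of "g x"] injD[OF permutes_inj[OF g(1)], of "g x" x] by auto
    then have "first_return S (f \<circ> g) x (induced_perm S f (g x))"
      using first_return_induced_perm[OF f] first_return_comp_right fixed by blast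
    then show ?thesis using induced_perm_eqI False by simp
  qed (simp add: fixed)
qed

lemma first_return_Un:
  assumes "first_return S f x y"
  shows "y \<notin> T \<Longrightarrow> first_return (S \<union> T) f x y"
    and "y \<in> T \<Longrightarrow> first_return (S \<union> T) f y z \<Longrightarrow> first_return (S \<union> T) f x z"
  using assms
  by (induction rule: first_return.induct) (auto intro: first_return.intros)

text \<open>Removing S and then T removes both: a first return outside T of first returns outside
  S is a concatenation of paths whose intermediate points lie in \<open>S \<union>
  T\<close>.\<close>

lemma induced_perm_Un:
  assumes f: "f permutes Z" "finite Z" and \<rho>: "induced_perm S f permutes Y" "finite Y"
    and "S \<inter> T = {}"
  shows "induced_perm T (induced_perm S f) = induced_perm (S \<union> T) f"
proof
  fix x
  let ?\<rho> = "induced_perm S f"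
  have nested: "x \<notin> S \<Longrightarrow> first_return (S \<union> T) f x y" if "first_return T ?\<rho> x y" for x y
    using that
  proof (induction rule: first_return.induct)
    case (direct x)
    then show ?case using first_return_induced_perm[OF f] first_return_Un(1) by blast
  next
    case (detour x y)
    then show ?case
      using first_return_induced_perm[OF f, of x S] first_return_Un(2) assms(5) by blast
  qed
  consider "x \<in> T" | "x \<in> S" | "x \<notin> S \<union> T" by blast
  then show "induced_perm T ?\<rho> x = induced_perm (S \<union> T) f x"
  proof cases
    case 2
    then have "first_return T ?\<rho> x x" using first_return.direct[of ?\<rho> x T] assms(5) by auto
    then have "induced_perm T ?\<rho> x = x" by (rule induced_perm_eqI) (use 2 assms(5) in auto)
    then show ?thesis using 2 by simp
  next
    case 3
    then have "first_return (S \<union> T) f x (induced_perm T ?\<rho> x)"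
      using nested first_return_induced_perm[OF \<rho>] by blast
    then show ?thesis using induced_perm_eqI 3 by metis
  qed simp
qed

text \<open>Paths can be run backwards. The second statement, about starting points in S, is what
  the induction needs to extend a reversed path by one more step inside S.\<close>

lemma first_return_reverse:
  assumes "first_return S f x y" "\<And>z. g (f z) = z"
  shows "x \<notin> S \<Longrightarrow> first_return S g y x"
    and "x \<in> S \<Longrightarrow> first_return S g x z \<Longrightarrow> first_return S g y z"
  using assms(1)
proof (induction arbitrary: z rule: first_return.induct)
  case (direct x)
  { case 1 then show ?case using first_return.direct[of g "f x"] assms(2) by simp }
  { case 2 then show ?case using first_return.detour[of g "f x"] assms(2) by simp }
next
  case (detour x y)
  { case 1 then show ?case
      using detour first_return.direct[of g "f x"] assms(2) by metis }
  { case 2 then show ?case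
      using detour first_return.detour[of g "f x"] assms(2) by metis }
qed

text \<open>Running paths backwards shows that the map induced by the inverse is a left
  inverse.\<close>

lemma induced_perm_permutes:
  assumes f: "f permutes Z" "finite Z"
  shows "induced_perm S f permutes (Z - S)"
proof (rule bij_imp_permutes)
  let ?\<rho> = "induced_perm S f"
  note ret = first_return_induced_perm[OF f]
  show "?\<rho> x = x" if "x \<notin> Z - S" for x
    using that first_return.direct[of f x S] induced_perm_eqI permutes_not_in[OF f(1)]
    by (metis DiffI induced_perm_in)
  have "?\<rho> x \<in> Z - S" if "x \<in> Z - S" for x
    using ret[of x S] that permutes_orbit_subset[OF f(1), of x]
      first_return_notin first_return_orbit by fast
  moreover have "inj_on ?\<rho> (Z - S)"
  proof (rule inj_on_inverseI)
    fix x assume x: "x \<in> Z - S"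
    then have "first_return S (inv f) (?\<rho> x) x" "?\<rho> x \<notin> S"
      using ret first_return_reverse(1) permutes_inverses(2)[OF f(1)] first_return_notin
      by (metis DiffD2)+
    then show "induced_perm S (inv f) (?\<rho> x) = x" by (rule induced_perm_eqI)
  qed
  ultimately show "bij_betw ?\<rho> (Z - S) (Z - S)"
    using f(2) by (simp only: bij_betw_def) (meson endo_inj_surj finite_Diff image_subsetI)
qed

lemma orbit_induced_perm:
  assumes f: "f permutes Z" "finite Z" and x: "x \<notin> S"
  shows "orbit (induced_perm S f) x = orbit f x - S"
proof (intro equalityI subsetI)
  let ?\<rho> = "induced_perm S f"
  note ret = first_return_induced_perm[OF f]
  show "y \<in> orbit f x - S" if "y \<in> orbit ?\<rho> x" for y
    using that
  proof (induction rule: orbit.induct)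
    case base
    show ?case using ret[OF x] by (auto dest: first_return_notin first_return_orbit)
  next
    case (step y)
    then have "first_return S f y (?\<rho> y)" using ret by blast
    then show ?case using step by (auto dest: first_return_notin first_return_orbit intro: orbit_trans)
  qed
  \<comment> \<open>The orbit of f is followed until its first return w, from which the orbit of the induced map takes over.\<close>
  have reach: "y = w \<or> y \<in> orbit ?\<rho> w"
    if "(f ^^ Suc n) x = y" "y \<notin> S" "first_return S f x w" for n x y w
    using that
  proof (induction n arbitrary: x w)
    case 0
    then show ?case by (auto elim: first_return.cases)
  next
    case (Suc n)
    have y: "(f ^^ Suc n) (f x) = y" using Suc.prems(1) by (simp add: funpow_swap1)
    show ?case
    proof (cases "f x \<in> S")
      case True
      then have "first_return S f (f x) w" using Suc.prems(3) by (auto elim: first_return.cases)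
      then show ?thesis using Suc.IH y Suc.prems(2) by blast
    next
      case False
      then have w: "w = f x" using Suc.prems(3) by (auto elim: first_return.cases)
      then have "y = ?\<rho> w \<or> y \<in> orbit ?\<rho> (?\<rho> w)"
        using Suc.IH[OF y Suc.prems(2) ret[OF False]] by simp
      then show ?thesis by (auto intro: orbit.base orbit_subset)
    qed
  qed
  show "y \<in> orbit ?\<rho> x" if "y \<in> orbit f x - S" for y
  proof -
    obtain n where "(f ^^ Suc n) x = y" using \<open>y \<in> _\<close> by (auto simp: orbit_altdef gr0_conv_Suc)
    then have "y = ?\<rho> x \<or> y \<in> orbit ?\<rho> (?\<rho> x)" using reach ret[OF x] that by blast
    then show ?thesis by (auto intro: orbit.base orbit_subset)
  qed
qed

section \<open>Orbits inside the removed set\<close>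

definition inner_orbits :: "nat set \<Rightarrow> (nat \<Rightarrow> nat) \<Rightarrow> nat set set" where
  "inner_orbits S f = orbit f ` {x \<in> S. orbit f x \<subseteq> S}"

lemma cyc0_eq_card_image: "cyc0 X f = card (orbit f ` {x \<in> X. 0 \<notin> orbit f x})"
  unfolding cyc0_def by (rule arg_cong[where f = card]) blast

text \<open>An orbit that is not inside S corresponds to its trace on the complement of S, which
  is an orbit of the induced permutation; exactly the orbits inside S are lost. As 0 is not in S,
  these do not contain 0.\<close>

lemma cyc0_induced_perm:
  assumes f: "f permutes Z" "finite Z" and S: "S \<subseteq> Z" "0 \<notin> S"
  shows "cyc0 Z f = cyc0 (Z - S) (induced_perm S f) + card (inner_orbits S f)"
proof -
  let ?\<rho> = "induced_perm S f"
  have self: "x \<in> orbit f x" for x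
    using f by (intro permutation_self_in_orbit) (auto simp: permutation_permutes)
  have orb: "orbit ?\<rho> x = orbit f x - S" if "x \<notin> S" for x
    using orbit_induced_perm[OF f that] .
  have same: "orbit f y = orbit f x" if "y \<in> orbit f x" for x y
    using cyclic_on_orbit[OF f] that by (rule orbit_cyclic_eq3)
  let ?A = "orbit f ` {x \<in> Z - S. 0 \<notin> orbit f x}"
  have "orbit f ` {x \<in> Z. 0 \<notin> orbit f x} = ?A \<union> inner_orbits S f"
  proof (intro equalityI subsetI)
    fix B assume "B \<in> orbit f ` {x \<in> Z. 0 \<notin> orbit f x}"
    then obtain x where x: "x \<in> Z" "0 \<notin> orbit f x" "B = orbit f x" by blast
    show "B \<in> ?A \<union> inner_orbits S f"
    proof (cases "orbit f x \<subseteq> S")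
      case True then show ?thesis using x self unfolding inner_orbits_def by blast
    next
      case False
      then obtain y where y: "y \<in> orbit f x" "y \<notin> S" by blast
      then have "y \<in> Z" using permutes_orbit_subset[OF f(1) x(1)] by blast
      then show ?thesis using same[OF y(1)] y(2) x by (metis (mono_tags, lifting) DiffI UnI1 imageI mem_Collect_eq)
    qed
  next
    fix B assume "B \<in> ?A \<union> inner_orbits S f"
    then show "B \<in> orbit f ` {x \<in> Z. 0 \<notin> orbit f x}"
      using S unfolding inner_orbits_def by blast
  qed
  moreover have "?A \<inter> inner_orbits S f = {}"
    using self unfolding inner_orbits_def by blast
  moreover have "finite ?A" "finite (inner_orbits S f)"
    using f(2) finite_subset[OF S(1)] unfolding inner_orbits_def by auto
  ultimately have "cyc0 Z f = card ?A + card (inner_orbits S f)"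
    unfolding cyc0_eq_card_image by (simp add: card_Un_disjoint)
  moreover have "orbit ?\<rho> ` {x \<in> Z - S. 0 \<notin> orbit ?\<rho> x} = (\<lambda>B. B - S) ` ?A"
    using orb S(2) by (auto simp: image_iff) 
  moreover have "inj_on (\<lambda>B. B - S) ?A"
  proof (rule inj_onI)
    fix B C assume "B \<in> ?A" "C \<in> ?A" and eq: "B - S = C - S"
    then obtain x y where xy: "B = orbit f x" "C = orbit f y" "x \<notin> S" by blast
    then have "x \<in> orbit f y" using self eq by blast
    then show "B = C" using same xy by simp
  qed
  ultimately show ?thesis by (simp add: cyc0_eq_card_image card_image)
qed

lemma inner_orbits_comp_right:
  assumes "\<And>z. z \<in> S \<Longrightarrow> g z = z"
  shows "inner_orbits S (f \<circ> g) = inner_orbits S f"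
proof -
  have 1: "orbit h' x = orbit h x" if "x \<in> S" "orbit h x \<subseteq> S" "\<And>z. z \<in> S \<Longrightarrow> h' z = h z" for h h' x
  proof -
    have "orbit h x = orbit h' x"
      by (rule orbit_cong0[of x "insert x (orbit h x)"])
        (use that in \<open>auto intro: orbit.intros\<close>)
    then show ?thesis by simp
  qed
  have "orbit (f \<circ> g) x = orbit f x" if "x \<in> S" "orbit f x \<subseteq> S \<or> orbit (f \<circ> g) x \<subseteq> S" for x
    using 1[of x f "f \<circ> g"] 1[of x "f \<circ> g" f] that assms by auto
  then show ?thesis unfolding inner_orbits_def by (intro image_cong) auto
qed

text \<open>An orbit inside S of one of the two maps never takes a value that g moves, so it is an
  orbit of the other one.\<close>

lemma inner_orbits_comp_left:
  assumes fixed: "\<And>z. z \<in> S \<Longrightarrow> g z = z" and "inj g"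
  shows "inner_orbits S (g \<circ> f) = inner_orbits S f"
proof -
  have in_S: "g z \<in> S \<longleftrightarrow> z \<in> S" for z
    using fixed[of z] fixed[of "g z"] injD[OF \<open>inj g\<close>, of "g z" z] by auto
  have 1: "orbit h' x = orbit h x"
    if "x \<in> S" "orbit h x \<subseteq> S" "\<And>z. h z \<in> S \<Longrightarrow> h' z = h z" for h h' :: "nat \<Rightarrow> nat" and x
  proof -
    have "orbit h x = orbit h' x"
    proof (rule orbit_cong0[of x "insert x (orbit h x)"])
      show "h y = h' y" if "y \<in> insert x (orbit h x)" for y
      proof -
        have "h y \<in> orbit h x" using that by (auto intro: orbit.intros)
        then show ?thesis using \<open>orbit h x \<subseteq> S\<close> \<open>\<And>z. h z \<in> S \<Longrightarrow> h' z = h z\<close> by auto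
      qed
    qed (auto intro: orbit.intros)
    then show ?thesis by simp
  qed
  have "orbit (g \<circ> f) x = orbit f x" if "x \<in> S" "orbit f x \<subseteq> S \<or> orbit (g \<circ> f) x \<subseteq> S" for x
    using 1[of x f "g \<circ> f"] 1[of x "g \<circ> f" f] that fixed in_S by auto
  then show ?thesis unfolding inner_orbits_def by (intro image_cong) auto
qed

text \<open>Additivity follows by telescoping the loss of orbits when S and T are removed one
  after the other; a direct count would have to deal with orbits inside \<open>S \<union>
  T\<close> that meet both sets.\<close>

lemma card_inner_orbits_Un:
  assumes f: "f permutes Z" "finite Z" and "S \<union> T \<subseteq> Z" "0 \<notin> S \<union> T" "S \<inter> T = {}"
  shows "card (inner_orbits (S \<union> T) f) = card (inner_orbits S f) + card (inner_orbits T (induced_perm S f))"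
proof -
  let ?\<rho> = "induced_perm S f"
  have \<rho>: "?\<rho> permutes Z - S" "finite (Z - S)"
    using induced_perm_permutes[OF f] f(2) by auto
  have "cyc0 Z f = cyc0 (Z - S) ?\<rho> + card (inner_orbits S f)"
    using assms by (intro cyc0_induced_perm) auto
  moreover have "cyc0 (Z - S) ?\<rho> = cyc0 (Z - S - T) (induced_perm T ?\<rho>) + card (inner_orbits T ?\<rho>)"
    using assms by (intro cyc0_induced_perm \<rho>) auto
  moreover have "cyc0 Z f = cyc0 (Z - (S \<union> T)) (induced_perm (S \<union> T) f) + card (inner_orbits (S \<union> T) f)"
    using assms by (intro cyc0_induced_perm) auto
  moreover have "induced_perm T ?\<rho> = induced_perm (S \<union> T) f" "Z - S - T = Z - (S \<union> T)"
    using induced_perm_Un[OF f \<rho>] assms by auto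
  ultimately show ?thesis by simp
qed


section \<open>Matchings\<close>

text \<open>The sets of pairs of the partitions of V into blocks of size one and two. The
  contraction along a partition depends only on its pairs, and unlike partitions, sets of pairs on
  disjoint supports can simply be joined.\<close>

definition matchings :: "nat set \<Rightarrow> nat set set set" where
  "matchings V = {M. (\<forall>B\<in>M. B \<subseteq> V \<and> card B = 2) \<and> disjoint M}"

lemma matchings_mono: "V \<subseteq> W \<Longrightarrow> matchings V \<subseteq> matchings W"
  unfolding matchings_def by blast

lemma matchings_Union: "M \<in> matchings V \<Longrightarrow> \<Union>M \<subseteq> V"
  unfolding matchings_def by blast

lemma finite_matching: "finite V \<Longrightarrow> M \<in> matchings V \<Longrightarrow> finite M"
  unfolding matchings_def by (rule finite_subset[of _ "Pow V"]) auto

lemma finite_matchings: "finite V \<Longrightarrow> finite (matchings V)"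
  unfolding matchings_def by (rule finite_subset[of _ "Pow (Pow V)"]) auto

lemma pairs_matching: "M \<in> matchings V \<Longrightarrow> pairs M = M"
  unfolding matchings_def pairs_def by blast

lemma supp_matching: "M \<in> matchings V \<Longrightarrow> supp M = \<Union>M"
  by (simp add: supp_def pairs_matching)

lemma card_Union_matching:
  assumes "M \<in> matchings V"
  shows "card (\<Union>M) = 2 * card M"
proof -
  have "finite B" if "B \<in> M" for B
    using assms that unfolding matchings_def by (metis (mono_tags, lifting) card.infinite mem_Collect_eq zero_neq_numeral)
  moreover have "pairwise disjnt M"
    using assms unfolding matchings_def by (simp add: disjoint_def pairwise_def disjnt_def)
  ultimately have "card (\<Union>M) = sum card M" by (intro card_Union_disjoint)
  also have "\<dots> = 2 * card M" using assms by (simp add: matchings_def)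
  finally show ?thesis .
qed

lemma matchings_Un_iff:
  assumes "M \<inter> N = {}"
  shows "M \<union> N \<in> matchings V \<longleftrightarrow> M \<in> matchings V \<and> N \<in> matchings (V - \<Union>M)"
proof
  assume MN: "M \<union> N \<in> matchings V"
  then have disj: "disjoint (M \<union> N)" and sub: "\<And>B. B \<in> M \<union> N \<Longrightarrow> B \<subseteq> V \<and> card B = 2"
    unfolding matchings_def by auto
  have cross: "B \<inter> C = {}" if "B \<in> M" "C \<in> N" for B C
    by (rule disjointD[OF disj]) (use that assms in auto)
  have "C \<subseteq> V - \<Union>M" if "C \<in> N" for C
    using sub[of C] cross[OF _ that] that by blast
  moreover have "disjoint M" "disjoint N"
    using disj by (auto intro: pairwise_subset)
  ultimately show "M \<in> matchings V \<and> N \<in> matchings (V - \<Union>M)"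
    using sub unfolding matchings_def by simp
next
  assume MN: "M \<in> matchings V \<and> N \<in> matchings (V - \<Union>M)"
  then have "\<forall>B\<in>M. \<forall>C\<in>N. B \<inter> C = {}" unfolding matchings_def by fast
  then have "\<Union>M \<inter> \<Union>N = {}" by blast
  then have "disjoint (M \<union> N)" using MN unfolding matchings_def by (intro disjoint_union) auto
  moreover have "C \<subseteq> V" if "C \<in> N" for C using MN that unfolding matchings_def by blast
  ultimately show "M \<union> N \<in> matchings V"
    using MN unfolding matchings_def by auto
qed

lemma matching_disjoint:
  assumes "N \<in> matchings (V - \<Union>M)"
  shows "M \<inter> N = {}"
proof (rule ccontr)
  assume "M \<inter> N \<noteq> {}"
  then obtain B where B: "B \<in> M" "B \<in> N" by blast
  then have "B \<subseteq> V - \<Union>M" "card B = 2" using assms unfolding matchings_def by auto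
  moreover have "B \<subseteq> \<Union>M" using B by blast
  ultimately show False by (auto simp: card_2_iff)
qed

lemma matching_partner:
  assumes "M \<in> matchings V" "x \<in> \<Union>M"
  obtains y where "{x, y} \<in> M" "y \<noteq> x"
proof -
  obtain B where B: "B \<in> M" "x \<in> B" using assms(2) by blast
  then have "card B = 2" using assms(1) unfolding matchings_def by blast
  then obtain y where "B = {x, y}" "y \<noteq> x"
    using B(2) by (auto simp: card_2_iff)
  then show ?thesis using that B(1) by blast
qed

lemma involution_pair:
  assumes "M \<in> matchings V" "{x, y} \<in> M"
  shows "involution M x = y"
proof -
  have "z = y" if "{x, z} \<in> M" for z
  proof -
    have "disjoint M" using assms(1) unfolding matchings_def by blast
    then have "{x, z} = {x, y}" using disjointD[OF _ that assms(2)] by blast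
    then show ?thesis by (auto simp: doubleton_eq_iff)
  qed
  then have "(THE z. {x, z} \<in> M) = y" using assms(2) by (intro the_equality)
  moreover have "x \<in> \<Union>M" using assms(2) by blast
  ultimately show ?thesis
    using assms(1) by (simp add: involution_def pairs_matching supp_matching)
qed

lemma involution_outside: "M \<in> matchings V \<Longrightarrow> x \<notin> \<Union>M \<Longrightarrow> involution M x = x"
  by (simp add: involution_def supp_matching)

lemma involution_involutive:
  assumes "M \<in> matchings V"
  shows "involution M (involution M x) = x"
proof (cases "x \<in> \<Union>M")
  case True
  then obtain y where "{x, y} \<in> M" using matching_partner[OF assms] by blast
  then show ?thesis using involution_pair[OF assms] by (metis insert_commute)
qed (simp add: involution_outside[OF assms])

lemma involution_permutes:
  assumes "M \<in> matchings V"
  shows "involution M permutes \<Union>M"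
  unfolding permutes_def using involution_involutive[OF assms] involution_outside[OF assms] by metis

lemma involution_Un:
  assumes "M \<union> N \<in> matchings V" "M \<inter> N = {}"
  shows "involution (M \<union> N) = involution N \<circ> involution M"
proof
  fix x
  have M: "M \<in> matchings V" and "N \<in> matchings (V - \<Union>M)"
    using assms matchings_Un_iff by auto
  then have N: "N \<in> matchings V" and disj: "\<Union>M \<inter> \<Union>N = {}"
    using matchings_mono[of "V - \<Union>M" V] matchings_Union by blast+
  consider "x \<in> \<Union>M" | "x \<in> \<Union>N" | "x \<notin> \<Union>(M \<union> N)" by blast
  then show "involution (M \<union> N) x = (involution N \<circ> involution M) x"
  proof cases
    case 1
    then obtain y where y: "{x, y} \<in> M" using matching_partner[OF M] by blast
    then have "y \<notin> \<Union>N" using disj by blast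
    then show ?thesis
      using y involution_pair[OF M y] involution_outside[OF N]
        involution_pair[OF assms(1), of x y] by simp
  next
    case 2
    then obtain y where y: "{x, y} \<in> N" using matching_partner[OF N] by blast
    have "x \<notin> \<Union>M" using disj 2 by blast
    then show ?thesis
      using y involution_pair[OF N y] involution_outside[OF M]
        involution_pair[OF assms(1), of x y] by simp
  next
    case 3
    then show ?thesis
      using involution_outside[OF M] involution_outside[OF N] involution_outside[OF assms(1)] by simp
  qed
qed

section \<open>Contractions before relabelling\<close>

text \<open>The permutation and the coefficient of a contraction before relabelling, when the
  points keep their names. All algebra of contractions takes place here, on permutations of
  arbitrary finite sets.\<close>

definition reduced :: "nat set set \<Rightarrow> (nat \<Rightarrow> nat) \<Rightarrow> nat \<Rightarrow> nat" where
  "reduced M \<alpha> = induced_perm (\<Union>M) (involution M \<circ> \<alpha>)"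

definition weight :: "real \<Rightarrow> nat set set \<Rightarrow> (nat \<Rightarrow> nat) \<Rightarrow> complex" where
  "weight q M \<alpha> = complex_of_real q powi
     (int (card M) - int (card (inner_orbits (\<Union>M) (involution M \<circ> \<alpha>))))"

lemma involution_comp_permutes:
  assumes "\<alpha> permutes Z" "M \<in> matchings (Z - {0})"
  shows "involution M \<circ> \<alpha> permutes Z"
  using assms involution_permutes[OF assms(2)] matchings_Union[OF assms(2)]
  by (intro permutes_compose) (auto intro: permutes_subset)

lemma reduced_permutes:
  assumes "\<alpha> permutes Z" "finite Z" "M \<in> matchings (Z - {0})"
  shows "reduced M \<alpha> permutes (Z - \<Union>M)"
  unfolding reduced_def using assms by (intro induced_perm_permutes involution_comp_permutes)

text \<open>With f the map for M, the map for \<open>M \<union> N\<close> is \<open>involution N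
  \<circ> f\<close>. Since the involution of N fixes the points removed by M, it can be taken out
  of the induced permutation, and it leaves the orbits inside \<open>\<Union>M\<close>
  unchanged.\<close>

lemma reduced_Un:
  assumes \<alpha>: "\<alpha> permutes Z" "finite Z" and MN: "M \<union> N \<in> matchings (Z - {0})" "M \<inter> N = {}"
  shows "reduced N (reduced M \<alpha>) = reduced (M \<union> N) \<alpha>"
    and "q \<noteq> 0 \<Longrightarrow> weight q (M \<union> N) \<alpha> = weight q M \<alpha> * weight q N (reduced M \<alpha>)"
proof -
  have M: "M \<in> matchings (Z - {0})" and N': "N \<in> matchings (Z - {0} - \<Union>M)"
    using MN matchings_Un_iff by auto
  then have N: "N \<in> matchings (Z - {0})" and disj: "\<Union>M \<inter> \<Union>N = {}"
    using matchings_mono[of "Z - {0} - \<Union>M" "Z - {0}"] matchings_Union by blast+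
  let ?f = "involution M \<circ> \<alpha>" and ?g = "involution (M \<union> N) \<circ> \<alpha>"
  have f: "?f permutes Z" using involution_comp_permutes \<alpha>(1) M .
  have g: "?g permutes Z" using involution_comp_permutes \<alpha>(1) MN(1) .
  have g_eq: "?g = involution N \<circ> ?f" using involution_Un[OF MN] by (simp add: o_assoc)
  have fixed: "involution N z = z" if "z \<in> \<Union>M" for z
    using that disj involution_outside[OF N] by blast
  have ind: "induced_perm (\<Union>M) ?g = involution N \<circ> reduced M \<alpha>"
    unfolding g_eq reduced_def
    using f \<alpha>(2) involution_permutes[OF N] disj by (intro induced_perm_comp_left) auto
  have "involution N \<circ> reduced M \<alpha> permutes Z - \<Union>M"
    using induced_perm_permutes[OF g \<alpha>(2), of "\<Union>M"] unfolding ind .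
  then show "reduced N (reduced M \<alpha>) = reduced (M \<union> N) \<alpha>"
    using induced_perm_Un[OF g \<alpha>(2), of "\<Union>M" "Z - \<Union>M" "\<Union>N"] disj \<alpha>(2)
    unfolding ind by (simp add: reduced_def)
  have "card (inner_orbits (\<Union>(M \<union> N)) ?g)
      = card (inner_orbits (\<Union>M) ?g) + card (inner_orbits (\<Union>N) (involution N \<circ> reduced M \<alpha>))"
  proof -
    have "\<Union>M \<union> \<Union>N \<subseteq> Z" "0 \<notin> \<Union>M \<union> \<Union>N"
      using matchings_Union[OF M] matchings_Union[OF N] by blast+
    then show ?thesis
      unfolding ind[symmetric] Union_Un_distrib by (rule card_inner_orbits_Un[OF g \<alpha>(2) _ _ disj])
  qed
  moreover have "inner_orbits (\<Union>M) ?g = inner_orbits (\<Union>M) ?f"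
    unfolding g_eq using fixed permutes_inj[OF involution_permutes[OF N]]
    by (rule inner_orbits_comp_left)
  moreover have "card (M \<union> N) = card M + card N"
    using finite_matching[of "Z - {0}"] \<alpha>(2) M N MN(2) by (intro card_Un_disjoint) auto
  ultimately show "weight q (M \<union> N) \<alpha> = weight q M \<alpha> * weight q N (reduced M \<alpha>)" if "q \<noteq> 0"
    using that unfolding weight_def by (subst power_int_add[symmetric]) (auto simp: algebra_simps)
qed

section \<open>Relabelling\<close>

lemma map_permutation_superset:
  assumes "p permutes Y" "Y \<subseteq> X" "inj_on r X"
  shows "map_permutation X r p = map_permutation Y r p"
proof
  fix z
  have Y: "inj_on r Y" using assms inj_on_subset by blast
  show "map_permutation X r p z = map_permutation Y r p z"
  proof (cases "z \<in> r ` X")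
    case True
    then obtain x where x: "x \<in> X" "z = r x" by blast
    then have *: "map_permutation X r p z = r (p x)" by (simp add: map_permutation_apply[OF assms(3)])
    show ?thesis
    proof (cases "x \<in> Y")
      case True
      then show ?thesis using * x map_permutation_apply[OF Y] by simp
    next
      case False
      then have "z \<notin> r ` Y" using x assms(2) inj_on_image_mem_iff[OF assms(3)] by blast
      then show ?thesis using * x False permutes_not_in[OF assms(1)]
        by (simp add: map_permutation_def restrict_id_def)
    qed
  next
    case False
    then have "z \<notin> r ` Y" using assms(2) by blast
    then show ?thesis using False by (simp add: map_permutation_def restrict_id_def)
  qed
qed

lemma map_permutation_outside: "z \<notin> r ` X \<Longrightarrow> map_permutation X r p z = z"
  by (simp add: map_permutation_def restrict_id_def)

text \<open>Renaming the points by r commutes with every ingredient of a contraction.\<close>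

context
  fixes X :: "nat set" and r :: "nat \<Rightarrow> nat" and f :: "nat \<Rightarrow> nat"
  assumes r: "inj_on r X" and f: "f permutes X" "finite X"
begin

lemma map_permutes: "map_permutation X r f permutes r ` X"
  using map_permutation_permutes[of r X "r ` X" f] r f(1) by (simp add: bij_betw_def)

lemma orbit_map_permutation:
  assumes "x \<in> X"
  shows "orbit (map_permutation X r f) (r x) = r ` orbit f x"
proof (rule orbit_inverse[symmetric])
  show "x \<in> orbit f x"
    using f by (intro permutation_self_in_orbit) (auto simp: permutation_permutes)
  show "map_permutation X r f (r y) = r (f y)" if "y \<in> orbit f x" for y
    using that permutes_orbit_subset[OF f(1) assms] map_permutation_apply[OF r] by blast
qed

lemma first_return_map_permutation:
  assumes "first_return S f x y" "x \<in> X" "S \<subseteq> X"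
  shows "first_return (r ` S) (map_permutation X r f) (r x) (r y)"
  using assms
proof (induction rule: first_return.induct)
  case (direct x)
  then have "r (f x) \<notin> r ` S"
    using inj_on_image_mem_iff[OF r] permutes_in_image[OF f(1)] by simp
  then show ?case
    using direct first_return.direct[of "map_permutation X r f" "r x" "r ` S"]
    by (simp add: map_permutation_apply[OF r])
next
  case (detour x y)
  then show ?case
    using first_return.detour[of "map_permutation X r f" "r x" "r ` S" "r y"]
    by (simp add: map_permutation_apply[OF r] permutes_in_image[OF f(1)])
qed

lemma induced_perm_map_permutation:
  assumes S: "S \<subseteq> X"
  shows "induced_perm (r ` S) (map_permutation X r f) = map_permutation X r (induced_perm S f)"
proof
  fix z
  show "induced_perm (r ` S) (map_permutation X r f) z = map_permutation X r (induced_perm S f) z"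
  proof (cases "z \<in> r ` X")
    case True
    then obtain x where x: "x \<in> X" "z = r x" by blast
    show ?thesis
    proof (cases "x \<in> S")
      case False
      then have "first_return (r ` S) (map_permutation X r f) (r x) (r (induced_perm S f x))"
        using first_return_map_permutation[OF first_return_induced_perm[OF f]] x(1) S by simp
      moreover have "r x \<notin> r ` S" using False x(1) S inj_on_image_mem_iff[OF r] by blast
      ultimately have "induced_perm (r ` S) (map_permutation X r f) (r x) = r (induced_perm S f x)"
        by (rule induced_perm_eqI)
      then show ?thesis using x by (simp add: map_permutation_apply[OF r])
    qed (use x in \<open>simp add: map_permutation_apply[OF r]\<close>)
  next
    case False
    then have "map_permutation X r f z = z" "z \<notin> r ` S"
      using S by (auto simp: map_permutation_outside)
    then have "first_return (r ` S) (map_permutation X r f) z z"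
      using first_return.direct[of "map_permutation X r f" z "r ` S"] by simp
    then have "induced_perm (r ` S) (map_permutation X r f) z = z"
      using \<open>z \<notin> r ` S\<close> by (rule induced_perm_eqI)
    then show ?thesis using False by (simp add: map_permutation_outside)
  qed
qed

lemma card_inner_orbits_map_permutation:
  assumes S: "S \<subseteq> X"
  shows "card (inner_orbits (r ` S) (map_permutation X r f)) = card (inner_orbits S f)"
proof -
  have orb: "orbit f x \<subseteq> X" if "x \<in> X" for x using permutes_orbit_subset[OF f(1) that] .
  have "r ` orbit f x \<subseteq> r ` S \<longleftrightarrow> orbit f x \<subseteq> S" if "x \<in> X" for x
    using inj_on_image_mem_iff[OF r _ S] orb[OF that]
    unfolding image_subset_iff by blast
  then have "{z \<in> r ` S. orbit (map_permutation X r f) z \<subseteq> r ` S} = r ` {x \<in> S. orbit f x \<subseteq> S}"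
    using orbit_map_permutation S by (auto 0 3 simp: subset_iff)
  then have "inner_orbits (r ` S) (map_permutation X r f) = (`) r ` inner_orbits S f"
    unfolding inner_orbits_def image_image
    by (simp only: image_image) (rule image_cong, use orbit_map_permutation S in auto)
  moreover have "\<Union>(inner_orbits S f) \<subseteq> X" using S unfolding inner_orbits_def by auto
  then have "inj_on ((`) r) (inner_orbits S f)" using inj_on_image inj_on_subset[OF r] by blast
  ultimately show ?thesis by (simp add: card_image)
qed

end

lemma image_matching:
  assumes M: "M \<in> matchings V" and r: "inj_on r V"
  shows "(`) r ` M \<in> matchings (r ` V)"
proof -
  have "card (r ` B) = 2" "r ` B \<subseteq> r ` V" if "B \<in> M" for B
  proof -
    have B: "B \<subseteq> V" "card B = 2" using M that unfolding matchings_def by auto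
    show "card (r ` B) = 2" using card_image[OF inj_on_subset[OF r B(1)]] B(2) by simp
    show "r ` B \<subseteq> r ` V" using B(1) by (rule image_mono)
  qed
  moreover have "disjoint ((`) r ` M)"
    using disjoint_image[OF inj_on_subset[OF r matchings_Union[OF M]]] M
    unfolding matchings_def by simp
  ultimately show ?thesis unfolding matchings_def by simp
qed

lemma involution_image:
  assumes r: "inj_on r X" and M: "M \<in> matchings X"
  shows "involution ((`) r ` M) = map_permutation X r (involution M)"
proof
  fix z
  have rM: "(`) r ` M \<in> matchings (r ` X)" using image_matching[OF M r] .
  have U: "\<Union>((`) r ` M) = r ` \<Union>M" by (simp add: image_Union)
  consider x where "x \<in> \<Union>M" "z = r x" | x where "x \<in> X - \<Union>M" "z = r x" | "z \<notin> r ` X"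
    by (metis DiffI imageE)
  then show "involution ((`) r ` M) z = map_permutation X r (involution M) z"
  proof cases
    case 1
    then obtain y where y: "{x, y} \<in> M" using matching_partner[OF M] by blast
    from imageI[OF y, of "(`) r"] have ry: "{r x, r y} \<in> (`) r ` M" by simp
    have x: "x \<in> X" using 1 matchings_Union[OF M] by blast
    show ?thesis
      unfolding 1(2) map_permutation_apply[OF r x] involution_pair[OF M y] involution_pair[OF rM ry] ..
  next
    case 2
    then have "z \<notin> r ` \<Union>M" using inj_on_image_mem_iff[OF r _ matchings_Union[OF M], of x] by simp
    then have "involution ((`) r ` M) z = z" using involution_outside[OF rM] U by simp
    then show ?thesis
      using 2 involution_outside[OF M, of x] by (simp add: map_permutation_apply[OF r])
  next
    case 3
    then have "z \<notin> r ` \<Union>M" using image_mono[OF matchings_Union[OF M], of r] by (meson subsetD)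
    then have "involution ((`) r ` M) z = z" using involution_outside[OF rM] U by simp
    then show ?thesis using 3 by (simp add: map_permutation_outside)
  qed
qed

lemma
  assumes r: "inj_on r X" and \<alpha>: "\<alpha> permutes X" "finite X" and M: "M \<in> matchings (X - {0})"
  shows reduced_image: "reduced ((`) r ` M) (map_permutation X r \<alpha>) = map_permutation X r (reduced M \<alpha>)"
    and weight_image: "weight q ((`) r ` M) (map_permutation X r \<alpha>) = weight q M \<alpha>"
proof -
  have MX: "M \<in> matchings X" using M matchings_mono[of "X - {0}" X] by blast
  let ?f = "involution M \<circ> \<alpha>"
  have f: "?f permutes X" using involution_comp_permutes[OF \<alpha>(1) M] .
  have eq: "involution ((`) r ` M) \<circ> map_permutation X r \<alpha> = map_permutation X r ?f"
    using map_permutation_compose'[OF r \<alpha>(1)] involution_image[OF r MX] by simp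
  have U: "\<Union>((`) r ` M) = r ` \<Union>M" by (simp add: image_Union)
  have MU: "\<Union>M \<subseteq> X" using matchings_Union[OF MX] .
  show "reduced ((`) r ` M) (map_permutation X r \<alpha>) = map_permutation X r (reduced M \<alpha>)"
    unfolding reduced_def eq U using induced_perm_map_permutation[OF r f \<alpha>(2) MU] .
  have "inj_on ((`) r) M"
    by (rule inj_on_image[OF inj_on_subset[OF r MU]])
  then have "card ((`) r ` M) = card M" by (rule card_image)
  then show "weight q ((`) r ` M) (map_permutation X r \<alpha>) = weight q M \<alpha>"
    unfolding weight_def eq U using card_inner_orbits_map_permutation[OF r f \<alpha>(2) MU] by simp
qed

definition rank :: "nat set \<Rightarrow> nat \<Rightarrow> nat" where
  "rank X x = card {y \<in> X. y < x}"

lemma relabel_eq: "relabel X \<alpha> = map_permutation X (rank X) \<alpha>"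
  unfolding relabel_def rank_def by simp

lemma rank_0 [simp]: "rank X 0 = 0"
  by (simp add: rank_def)

lemma rank_less:
  assumes "finite X" "x \<in> X" "x < y"
  shows "rank X x < rank X y"
  unfolding rank_def using assms by (intro psubset_card_mono) auto

lemma inj_on_rank: "finite X \<Longrightarrow> inj_on (rank X) X"
  by (rule linorder_inj_onI') (use rank_less in fastforce)

lemma rank_image:
  assumes "finite X" "0 \<in> X"
  shows "rank X ` X = {0..card X - 1}"
proof (rule card_subset_eq)
  have "rank X x < card X" if "x \<in> X" for x
    unfolding rank_def using assms that by (intro psubset_card_mono) auto
  then show "rank X ` X \<subseteq> {0..card X - 1}" by (auto simp: Suc_le_eq dest!: less_imp_le_nat) fastforce
  have "card X \<noteq> 0" using assms by auto
  then show "card (rank X ` X) = card {0..card X - 1}"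
    using inj_on_rank[OF assms(1)] by (simp add: card_image)
qed simp

lemma rank_image_nonzero:
  assumes "finite X" "0 \<in> X"
  shows "rank X ` (X - {0}) = {1..card X - 1}"
proof -
  have "rank X ` (X - {0}) = rank X ` X - {0}"
    using inj_on_image_set_diff[OF inj_on_rank[OF assms(1)], of X "{0}"] assms by simp
  then show ?thesis using rank_image[OF assms] by auto
qed

lemma rank_strict_mono_image:
  assumes "\<And>x y. x \<in> X \<Longrightarrow> y \<in> X \<Longrightarrow> x < y \<Longrightarrow> r x < r y" "x \<in> X"
  shows "rank (r ` X) (r x) = rank X x"
proof -
  have less: "r y < r x \<longleftrightarrow> y < x" if "y \<in> X" for y
    using assms that by (metis linorder_neqE_nat order_less_asym order_less_irrefl)
  have "{z \<in> r ` X. z < r x} = r ` {y \<in> X. y < x}"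
    using less by auto
  moreover have "inj_on r {y \<in> X. y < x}"
    by (rule linorder_inj_onI') (use assms(1) in fastforce)
  ultimately show ?thesis unfolding rank_def by (simp add: card_image)
qed

text \<open>The basis vector of a permutation of an arbitrary finite set X containing 0, after the
  order-preserving relabelling by \<open>{0..card X - 1}\<close>.\<close>

definition vec :: "nat set \<Rightarrow> (nat \<Rightarrow> nat) \<Rightarrow> palg" where
  "vec X \<alpha> = basis_elt (card X - 1) (relabel X \<alpha>)"

lemma vec_map_permutation:
  assumes mono: "\<And>x y. x \<in> X \<Longrightarrow> y \<in> X \<Longrightarrow> x < y \<Longrightarrow> r x < r y" and "finite X"
    and \<alpha>: "\<alpha> permutes X"
  shows "vec (r ` X) (map_permutation X r \<alpha>) = vec X \<alpha>"
proof -
  have r: "inj_on r X" by (rule linorder_inj_onI') (use mono in fastforce)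
  have inj: "inj_on (rank (r ` X)) (r ` X)" using assms(2) by (intro inj_on_rank) auto
  have "relabel (r ` X) (map_permutation X r \<alpha>) = map_permutation X (rank (r ` X) \<circ> r) \<alpha>"
    unfolding relabel_eq using r inj by (intro map_permutation_compose) (auto simp: bij_betw_def)
  also have "\<dots> = relabel X \<alpha>"
    unfolding relabel_eq
  proof (intro map_permutation_cong)
    show "(rank (r ` X) \<circ> r) x = rank X x" if "x \<in> X" for x
      using rank_strict_mono_image[of X r x] mono that by simp
  qed (use r inj \<alpha> in \<open>auto intro: comp_inj_on\<close>)
  finally show ?thesis using r by (simp add: vec_def card_image)
qed

lemma vec_atLeastAtMost:
  assumes "\<alpha> permutes {0..n}"
  shows "vec {0..n} \<alpha> = basis_elt n \<alpha>"
proof -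
  have "rank {0..n} x = x" if "x \<in> {0..n}" for x
  proof -
    have "{y \<in> {0..n}. y < x} = {..<x}" using that by auto
    then show ?thesis by (simp add: rank_def)
  qed
  then have "relabel {0..n} \<alpha> = map_permutation {0..n} id \<alpha>"
    unfolding relabel_eq using assms
    by (intro map_permutation_cong inj_on_rank) auto
  then show ?thesis using assms by (simp add: vec_def)
qed

section \<open>Contractions after relabelling\<close>

lemma contraction_cong: "pairs \<pi> = pairs \<pi>' \<Longrightarrow> contraction q \<pi> = contraction q \<pi>'"
proof -
  assume "pairs \<pi> = pairs \<pi>'"
  moreover from this have "involution \<pi> = involution \<pi>'"
    by (simp add: fun_eq_iff involution_def supp_def)
  ultimately show ?thesis by (simp add: contraction_def contraction_basis_def supp_def)
qed

text \<open>The exponent of q in a contraction is the number of pairs minus the number of orbits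
  that disappear.\<close>

lemma contraction_basis_elt:
  assumes \<alpha>: "\<alpha> permutes {0..n}" and M: "M \<in> matchings {1..n}"
  shows "contraction q M (basis_elt n \<alpha>) = scale (weight q M \<alpha>) (vec ({0..n} - \<Union>M) (reduced M \<alpha>))"
proof -
  have Z: "{0..n} - {0} = {1..n}" by auto
  have U: "\<Union>M \<subseteq> {1..n}" using matchings_Union[OF M] .
  have "involution M \<circ> \<alpha> permutes {0..n}" using involution_comp_permutes[OF \<alpha>] M Z by simp
  from cyc0_induced_perm[OF this, of "\<Union>M"] U
  have "cyc0 {0..n} (involution M \<circ> \<alpha>) = cyc0 ({0..n} - \<Union>M) (reduced M \<alpha>)
      + card (inner_orbits (\<Union>M) (involution M \<circ> \<alpha>))"
    unfolding reduced_def by fastforce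
  then have "int (cyc0 ({0..n} - \<Union>M) (reduced M \<alpha>)) - int (cyc0 {0..n} (involution M \<circ> \<alpha>)) + int (card M)
      = int (card M) - int (card (inner_orbits (\<Union>M) (involution M \<circ> \<alpha>)))" by simp
  moreover have "card ({0..n} - \<Union>M) = Suc n - 2 * card M"
    using card_Diff_subset[of "\<Union>M" "{0..n}"] card_Union_matching[OF M] finite_subset[OF U]
      order_trans[OF U, of "{0..n}"] by simp
  ultimately show ?thesis
    unfolding contraction_def basis_elt_def lin_ext_single
    by (simp add: contraction_basis_def Let_def pairs_matching[OF M] supp_matching[OF M]
        reduced_def[symmetric] weight_def vec_def basis_elt_def)
qed

text \<open>Relabelling before contracting and once more afterwards amounts to one relabelling at
  the end.\<close>

lemma contraction_vec:
  assumes X: "finite X" "0 \<in> X" and \<alpha>: "\<alpha> permutes X" and M: "M \<in> matchings (X - {0})"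
  shows "contraction q ((`) (rank X) ` M) (vec X \<alpha>) = scale (weight q M \<alpha>) (vec (X - \<Union>M) (reduced M \<alpha>))"
proof -
  let ?r = "rank X"
  have r: "inj_on ?r X" using inj_on_rank[OF X(1)] .
  have "inj_on ?r (X - {0})" by (rule inj_on_subset[OF r]) auto
  then have rM: "(`) ?r ` M \<in> matchings {1..card X - 1}"
    using image_matching[OF M] rank_image_nonzero[OF X] by metis
  have \<alpha>': "relabel X \<alpha> permutes {0..card X - 1}"
    unfolding relabel_eq using map_permutes[OF r \<alpha> X(1)] rank_image[OF X] by simp
  have \<rho>: "reduced M \<alpha> permutes X - \<Union>M" using reduced_permutes[OF \<alpha> X(1) M] .
  have "?r ` (X - \<Union>M) = {0..card X - 1} - \<Union>((`) ?r ` M)"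
    using inj_on_image_set_diff[OF r, of X "\<Union>M"] matchings_Union[OF M] rank_image[OF X]
    by (auto simp: image_Union)
  moreover have "map_permutation X ?r (reduced M \<alpha>) = map_permutation (X - \<Union>M) ?r (reduced M \<alpha>)"
    using \<rho> r by (intro map_permutation_superset) auto
  ultimately have "vec ({0..card X - 1} - \<Union>((`) ?r ` M)) (map_permutation X ?r (reduced M \<alpha>))
      = vec (X - \<Union>M) (reduced M \<alpha>)"
    using vec_map_permutation[OF _ _ \<rho>, of ?r] rank_less X(1) by auto
  then show ?thesis
    using contraction_basis_elt[OF \<alpha>' rM] reduced_image[OF r \<alpha> X(1) M] weight_image[OF r \<alpha> X(1) M]
    unfolding vec_def[of X] relabel_eq[symmetric] by (simp add: relabel_eq)
qed

lemma contraction_contraction: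
  assumes "q \<noteq> 0" and \<alpha>: "\<alpha> permutes {0..n}"
    and M: "M \<in> matchings {1..n}" and N: "N \<in> matchings ({1..n} - \<Union>M)"
  shows "contraction q ((`) (rank ({0..n} - \<Union>M)) ` N) (contraction q M (basis_elt n \<alpha>))
    = contraction q (M \<union> N) (basis_elt n \<alpha>)"
proof -
  have Z: "{0..n} - {0} = {1..n}" by auto
  have disj: "M \<inter> N = {}" using matching_disjoint[OF N] .
  have MN: "M \<union> N \<in> matchings {1..n}" using matchings_Un_iff[OF disj] M N by blast
  let ?X = "{0..n} - \<Union>M"
  have zero: "0 \<in> ?X" and X0: "?X - {0} = {1..n} - \<Union>M" using matchings_Union[OF M] by auto
  have \<rho>: "reduced M \<alpha> permutes ?X" using reduced_permutes[OF \<alpha>] M Z by simp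
  have "contraction q ((`) (rank ?X) ` N) (vec ?X (reduced M \<alpha>))
      = scale (weight q N (reduced M \<alpha>)) (vec (?X - \<Union>N) (reduced N (reduced M \<alpha>)))"
    using contraction_vec[of ?X, OF _ zero \<rho>] N X0 by simp
  moreover have "?X - \<Union>N = {0..n} - \<Union>(M \<union> N)" by blast
  moreover note reduced_Un[OF \<alpha> _ _ disj] 
  ultimately show ?thesis
    using MN Z assms(1) contraction_basis_elt[OF \<alpha> M] contraction_basis_elt[OF \<alpha> MN]
    by (simp add: module_hom.scale[OF linear_contraction])
qed

lemma contraction_empty: "\<alpha> permutes {0..n} \<Longrightarrow> contraction q {} (basis_elt n \<alpha>) = basis_elt n \<alpha>"
proof -
  assume \<alpha>: "\<alpha> permutes {0..n}"
  have empty: "{} \<in> matchings {1..n}" by (simp add: matchings_def)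
  have "involution {} = id" by (auto simp: involution_def supp_def pairs_def)
  moreover have "induced_perm {} \<alpha> = \<alpha>"
    using induced_perm_eqI[OF first_return.direct] by fastforce
  ultimately have "reduced {} \<alpha> = \<alpha>" by (simp add: reduced_def)
  then show ?thesis
    using contraction_basis_elt[OF \<alpha> empty] vec_atLeastAtMost[OF \<alpha>]
    by (simp add: weight_def inner_orbits_def)
qed


section \<open>Sums over matchings\<close>

lemma bij_betw_matchings_image:
  assumes r: "inj_on r V"
  shows "bij_betw ((`) ((`) r)) (matchings V) (matchings (r ` V))"
  unfolding bij_betw_def
proof
  have "inj_on ((`) ((`) r)) (Pow (Pow V))" using r by (intro inj_on_image_Pow)
  then show "inj_on ((`) ((`) r)) (matchings V)"
    by (rule inj_on_subset) (auto simp: matchings_def)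
  show "(`) ((`) r) ` matchings V = matchings (r ` V)"
  proof (intro equalityI subsetI)
    show "N \<in> matchings (r ` V)" if "N \<in> (`) ((`) r) ` matchings V" for N
      using that image_matching[OF _ r] by blast
    fix N assume N: "N \<in> matchings (r ` V)"
    have sub: "B \<subseteq> r ` V" if "B \<in> N" for B using N that unfolding matchings_def by blast
    let ?M = "(`) (inv_into V r) ` N"
    have "?M \<in> matchings (inv_into V r ` r ` V)"
      using N by (rule image_matching) (rule inj_on_inv_into, rule order_refl)
    moreover have "inv_into V r ` r ` V = V" using r by (auto simp: image_image)
    moreover have "(`) r ` ?M = N"
    proof -
      have "r ` inv_into V r ` B = B" if "B \<in> N" for B
        using sub[OF that] by (rule image_inv_into_cancel[OF refl])
      then show ?thesis by (simp add: image_image)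
    qed
    ultimately show "N \<in> (`) ((`) r) ` matchings V" by (metis imageI)
  qed
qed

text \<open>Choosing M and then N on the remaining points is the same as choosing \<open>\<Theta>
  = M \<union> N\<close> and then its part M. The set A restricts the pairs allowed in M.\<close>

lemma sum_matchings_nested:
  fixes g :: "nat set set \<Rightarrow> nat set set \<Rightarrow> 'a::comm_monoid_add"
  assumes V: "finite V"
  shows "(\<Sum>M | M \<in> matchings V \<and> M \<subseteq> A. \<Sum>N\<in>matchings (V - \<Union>M). g M N)
    = (\<Sum>\<Theta>\<in>matchings V. \<Sum>M\<in>Pow (\<Theta> \<inter> A). g M (\<Theta> - M))"
proof -
  have fin: "finite {M. M \<in> matchings V \<and> M \<subseteq> A}" "finite (matchings V)"
    "\<And>M. finite (matchings (V - \<Union>M))"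
    using finite_matchings V by simp_all
  have fin2: "finite (Pow (\<Theta> \<inter> A))" if "\<Theta> \<in> matchings V" for \<Theta>
    using finite_matching[OF V that] by simp
  have split: "M \<in> matchings V \<and> \<Theta> - M \<in> matchings (V - \<Union>M)" if "\<Theta> \<in> matchings V" "M \<subseteq> \<Theta>" for M \<Theta>
    using matchings_Un_iff[of M "\<Theta> - M" V] that by (simp add: Un_absorb1)
  have join: "M \<union> N \<in> matchings V"
    if "M \<in> matchings V" "N \<in> matchings (V - \<Union>M)" for M N
    using matchings_Un_iff[of M N V] matching_disjoint[OF that(2)] that by auto
  have apart: False if "N \<in> matchings (V - \<Union>M)" "B \<in> M" "B \<in> N" for M N B
    using matching_disjoint[OF that(1)] that by blast
  then have cancel: "M \<union> N - M = N" if "N \<in> matchings (V - \<Union>M)" for M N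
    using that by blast
  have "(\<Sum>M | M \<in> matchings V \<and> M \<subseteq> A. \<Sum>N\<in>matchings (V - \<Union>M). g M N)
      = (\<Sum>(M, N)\<in>(SIGMA M:{M. M \<in> matchings V \<and> M \<subseteq> A}. matchings (V - \<Union>M)). g M N)"
    using fin by (intro sum.Sigma) auto
  also have "\<dots> = (\<Sum>(\<Theta>, M)\<in>(SIGMA \<Theta>:matchings V. Pow (\<Theta> \<inter> A)). g M (\<Theta> - M))"
    by (rule sum.reindex_bij_witness[of _ "\<lambda>(\<Theta>, M). (M, \<Theta> - M)" "\<lambda>(M, N). (M \<union> N, M)"])
      (use split join cancel in \<open>auto simp: Un_absorb1 dest: apart\<close>)
  also have "\<dots> = (\<Sum>\<Theta>\<in>matchings V. \<Sum>M\<in>Pow (\<Theta> \<inter> A). g M (\<Theta> - M))"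
    using fin fin2 by (intro sum.Sigma[symmetric]) auto
  finally show ?thesis .
qed

lemma sum_Pow_card:
  fixes f :: "nat \<Rightarrow> 'a::comm_semiring_1"
  assumes "finite T"
  shows "(\<Sum>M\<in>Pow T. f (card M)) = (\<Sum>j\<le>card T. of_nat (card T choose j) * f j)"
proof -
  have "(\<Sum>M\<in>Pow T. f (card M)) = (\<Sum>j\<le>card T. \<Sum>M | M \<in> Pow T \<and> card M = j. f (card M))"
    using assms by (intro sum.group[symmetric]) (auto intro: card_mono)
  also have "\<dots> = (\<Sum>j\<le>card T. of_nat (card T choose j) * f j)"
    using n_subsets[OF assms] by (intro sum.cong) auto
  finally show ?thesis .
qed

section \<open>Operators that weight a contraction by its number of pairs\<close>

text \<open>The sum of the contractions with k pairs is the divided power \<open>lap q ^^ k / fact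
  k\<close>, so that c collects the coefficients of F as an exponential generating function in the
  Laplacian.\<close>

definition contraction_series :: "real \<Rightarrow> (nat \<Rightarrow> complex) \<Rightarrow> (palg \<Rightarrow> palg) \<Rightarrow> bool" where
  "contraction_series q c F \<longleftrightarrow> linear_op F \<and>
     (\<forall>n \<alpha>. \<alpha> permutes {0..n} \<longrightarrow> F (basis_elt n \<alpha>) =
       (\<Sum>M\<in>matchings {1..n}. scale (c (card M)) (contraction q M (basis_elt n \<alpha>))))"

text \<open>The series of F applies on the relabelled points; bringing the matchings there back to
  the points left over by M turns the composed contractions into contractions along \<open>M
  \<union> N\<close>.\<close>

lemma contraction_series_contraction:
  assumes F: "contraction_series q c F" and q: "q \<noteq> 0"
    and \<alpha>: "\<alpha> permutes {0..n}" and M: "M \<in> matchings {1..n}"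
  shows "F (contraction q M (basis_elt n \<alpha>)) =
    (\<Sum>N\<in>matchings ({1..n} - \<Union>M). scale (c (card N)) (contraction q (M \<union> N) (basis_elt n \<alpha>)))"
proof -
  let ?X = "{0..n} - \<Union>M"
  let ?w = "weight q M \<alpha>" and ?v = "vec ?X (reduced M \<alpha>)"
  have zero: "0 \<in> ?X" and X0: "?X - {0} = {1..n} - \<Union>M" using matchings_Union[OF M] by auto
  have r: "inj_on (rank ?X) ?X" by (intro inj_on_rank) simp
  then have r': "inj_on (rank ?X) ({1..n} - \<Union>M)" by (rule inj_on_subset) auto
  have im: "rank ?X ` ({1..n} - \<Union>M) = {1..card ?X - 1}"
    using rank_image_nonzero[of ?X] zero X0 by simp
  have Z: "{0..n} - {0} = {1..n}" by auto
  have "reduced M \<alpha> permutes ?X" using reduced_permutes[OF \<alpha>] M Z by simp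
  then have \<rho>: "relabel ?X (reduced M \<alpha>) permutes {0..card ?X - 1}"
    unfolding relabel_eq using map_permutes[OF r] rank_image[of ?X] zero by simp
  have C: "contraction q M (basis_elt n \<alpha>) = scale ?w ?v"
    using contraction_basis_elt[OF \<alpha> M] .
  have lin: "linear_op F" using F unfolding contraction_series_def by blast
  have "F ?v = (\<Sum>N\<in>matchings {1..card ?X - 1}. scale (c (card N)) (contraction q N ?v))"
    unfolding vec_def using F \<rho> unfolding contraction_series_def by blast
  also have "\<dots> = (\<Sum>N\<in>matchings ({1..n} - \<Union>M).
      scale (c (card ((`) (rank ?X) ` N))) (contraction q ((`) (rank ?X) ` N) ?v))"
    using sum.reindex_bij_betw[OF bij_betw_matchings_image[OF r'],
        of "\<lambda>N. scale (c (card N)) (contraction q N ?v)"] im by simp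
  finally have "F (scale ?w ?v) = (\<Sum>N\<in>matchings ({1..n} - \<Union>M).
      scale (c (card ((`) (rank ?X) ` N))) (contraction q ((`) (rank ?X) ` N) (scale ?w ?v)))"
    by (simp add: module_hom.scale[OF lin] module_hom.scale[OF linear_contraction]
        free.scale_sum_right free.scale_left_commute del: free.scale_scale)
  also have "\<dots> = (\<Sum>N\<in>matchings ({1..n} - \<Union>M). scale (c (card N)) (contraction q (M \<union> N) (basis_elt n \<alpha>)))"
  proof (rule sum.cong)
    fix N assume N: "N \<in> matchings ({1..n} - \<Union>M)"
    have "inj_on ((`) (rank ?X)) N"
      by (rule inj_on_image, rule inj_on_subset[OF r' matchings_Union[OF N]])
    then have "card ((`) (rank ?X) ` N) = card N" by (rule card_image)
    then show "scale (c (card ((`) (rank ?X) ` N))) (contraction q ((`) (rank ?X) ` N) (scale ?w ?v))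
      = scale (c (card N)) (contraction q (M \<union> N) (basis_elt n \<alpha>))"
      using contraction_contraction[OF q \<alpha> M N] C by simp
  qed simp
  finally show ?thesis using C by simp
qed

lemma sum_contraction_series:
  assumes F: "contraction_series q d F" and q: "q \<noteq> 0" and \<alpha>: "\<alpha> permutes {0..n}"
  shows "(\<Sum>M | M \<in> matchings {1..n} \<and> M \<subseteq> A. scale (c (card M)) (F (contraction q M (basis_elt n \<alpha>))))
    = (\<Sum>\<Theta>\<in>matchings {1..n}. scale (\<Sum>M\<in>Pow (\<Theta> \<inter> A). c (card M) * d (card \<Theta> - card M))
        (contraction q \<Theta> (basis_elt n \<alpha>)))"
proof -
  let ?C = "\<lambda>M. contraction q M (basis_elt n \<alpha>)"
  have "(\<Sum>M | M \<in> matchings {1..n} \<and> M \<subseteq> A. scale (c (card M)) (F (?C M)))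
    = (\<Sum>M | M \<in> matchings {1..n} \<and> M \<subseteq> A. \<Sum>N\<in>matchings ({1..n} - \<Union>M).
        scale (c (card M) * d (card N)) (?C (M \<union> N)))"
    by (intro sum.cong)
      (auto simp: contraction_series_contraction[OF F q \<alpha>] free.scale_sum_right)
  also have "\<dots> = (\<Sum>\<Theta>\<in>matchings {1..n}. \<Sum>M\<in>Pow (\<Theta> \<inter> A).
        scale (c (card M) * d (card (\<Theta> - M))) (?C (M \<union> (\<Theta> - M))))"
    by (rule sum_matchings_nested) simp
  also have "\<dots> = (\<Sum>\<Theta>\<in>matchings {1..n}. \<Sum>M\<in>Pow (\<Theta> \<inter> A).
        scale (c (card M) * d (card \<Theta> - card M)) (?C \<Theta>))"
  proof (intro sum.cong refl)
    fix \<Theta> M assume "\<Theta> \<in> matchings {1..n}" "M \<in> Pow (\<Theta> \<inter> A)"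
    moreover from this have "M \<subseteq> \<Theta>" "finite M"
      using finite_matching[of "{1..n}" \<Theta>] by (auto intro: finite_subset)
    ultimately show "scale (c (card M) * d (card (\<Theta> - M))) (?C (M \<union> (\<Theta> - M)))
      = scale (c (card M) * d (card \<Theta> - card M)) (?C \<Theta>)"
      by (simp add: card_Diff_subset Un_absorb1)
  qed
  finally show ?thesis by (simp add: free.scale_sum_left)
qed

text \<open>Each matching \<open>\<Theta>\<close> is split into the j pairs contracted by F and
  the remaining ones contracted by G, whence the binomial coefficient.\<close>

lemma contraction_series_compose:
  assumes F: "contraction_series q c F" and G: "contraction_series q d G" and q: "q \<noteq> 0"
  shows "contraction_series q (\<lambda>k. \<Sum>j\<le>k. of_nat (k choose j) * (c j * d (k - j))) (\<lambda>x. G (F x))"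
proof -
  have lin: "linear_op F" "linear_op G" using F G unfolding contraction_series_def by blast+
  have "G (F (basis_elt n \<alpha>)) = (\<Sum>\<Theta>\<in>matchings {1..n}.
      scale (\<Sum>j\<le>card \<Theta>. of_nat (card \<Theta> choose j) * (c j * d (card \<Theta> - j))) (contraction q \<Theta> (basis_elt n \<alpha>)))"
    if \<alpha>: "\<alpha> permutes {0..n}" for n \<alpha>
  proof -
    have "G (F (basis_elt n \<alpha>)) = (\<Sum>M\<in>matchings {1..n}. scale (c (card M)) (G (contraction q M (basis_elt n \<alpha>))))"
      using F \<alpha> unfolding contraction_series_def
      by (simp add: module_hom.sum[OF lin(2)] module_hom.scale[OF lin(2)])
    also have "\<dots> = (\<Sum>\<Theta>\<in>matchings {1..n}. scale (\<Sum>M\<in>Pow \<Theta>. c (card M) * d (card \<Theta> - card M))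
        (contraction q \<Theta> (basis_elt n \<alpha>)))"
      using sum_contraction_series[OF G q \<alpha>, where A = UNIV] by simp
    also have "\<dots> = (\<Sum>\<Theta>\<in>matchings {1..n}.
      scale (\<Sum>j\<le>card \<Theta>. of_nat (card \<Theta> choose j) * (c j * d (card \<Theta> - j))) (contraction q \<Theta> (basis_elt n \<alpha>)))"
    proof (intro sum.cong refl)
      fix \<Theta> assume "\<Theta> \<in> matchings {1..n}"
      then have "finite \<Theta>" by (rule finite_matching[rotated]) simp
      then show "scale (\<Sum>M\<in>Pow \<Theta>. c (card M) * d (card \<Theta> - card M)) (contraction q \<Theta> (basis_elt n \<alpha>))
        = scale (\<Sum>j\<le>card \<Theta>. of_nat (card \<Theta> choose j) * (c j * d (card \<Theta> - j))) (contraction q \<Theta> (basis_elt n \<alpha>))"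
        using sum_Pow_card[of \<Theta> "\<lambda>j. c j * d (card \<Theta> - j)"] by simp
    qed
    finally show ?thesis .
  qed
  then show ?thesis unfolding contraction_series_def using linear_op_compose[OF lin] by blast
qed

section \<open>The Laplacian, its exponential and the Wick map\<close>

lemma pairs_cycle_partition_transpose:
  assumes "i \<in> {1..n}" "j \<in> {1..n}" "i \<noteq> j"
  shows "pairs (cycle_partition n (transpose i j)) = {{i, j}}"
proof (intro equalityI subsetI)
  fix B assume "B \<in> pairs (cycle_partition n (transpose i j))"
  then obtain x where x: "B = {x, transpose i j x}" "card B = 2"
    unfolding pairs_def cycle_partition_def by blast
  then have "transpose i j x \<noteq> x" by auto
  then have "x = i \<or> x = j" by (metis transpose_apply_other)
  then show "B \<in> {{i, j}}" using x(1) by auto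
next
  fix B assume B: "B \<in> {{i, j}}"
  then have "B = {i, transpose i j i}" "card B = 2" using assms(3) by auto
  then show "B \<in> pairs (cycle_partition n (transpose i j))"
    unfolding pairs_def cycle_partition_def using assms(1) by blast
qed

lemma two_element_set:
  assumes "card B = 2"
  obtains i j :: nat where "i < j" "B = {i, j}"
proof -
  obtain i j where "B = {i, j}" "i \<noteq> j" using assms by (auto simp: card_2_iff)
  then show ?thesis using that[of i j] that[of j i] by (cases "i < j") (auto simp: insert_commute)
qed

text \<open>A transposition is identified with the set of the two points that it moves; Min and
  Max only serve to recover the transposition from this set.\<close>

lemma lap_basis_elt:
  "lap q (basis_elt n \<alpha>) = (\<Sum>B | B \<subseteq> {1..n} \<and> card B = 2. contraction q {B} (basis_elt n \<alpha>))"
proof -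
  let ?E = "{B. B \<subseteq> {1..n} \<and> card B = 2}" and ?t = "\<lambda>B. transpose (Min B) (Max B)"
  have moved: "{x. transpose i j x \<noteq> x} = {i, j}" if "i \<noteq> j" for i j :: nat
    using that by (auto simp: transpose_def)
  have t: "?t {i, j} = transpose i j" if "i < j" for i j :: nat
    using that by simp
  have E: "\<exists>i j. i < j \<and> B = {i, j} \<and> i \<in> {1..n} \<and> j \<in> {1..n}" if "B \<in> ?E" for B
  proof -
    have B: "B \<subseteq> {1..n}" "card B = 2" using that by auto
    from B(2) obtain i j where "i < j" "B = {i, j}" by (rule two_element_set)
    then show ?thesis using B(1) by blast
  qed
  have T: "\<exists>i j. i < j \<and> \<tau> = transpose i j \<and> i \<in> {1..n} \<and> j \<in> {1..n}" if \<tau>: "\<tau> \<in> transpositions n" for \<tau>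
  proof -
    obtain i j where ij: "\<tau> = transpose i j" "i \<in> {1..n}" "j \<in> {1..n}" "i \<noteq> j"
      using \<tau> unfolding transpositions_def by blast
    then consider "i < j" | "j < i" by linarith
    then show ?thesis
    proof cases
      case 2
      then have "\<tau> = transpose j i" using ij by (simp add: transpose_commute)
      then show ?thesis using 2 ij by blast
    qed (use ij in blast)
  qed
  have "bij_betw ?t ?E (transpositions n)"
  proof (rule bij_betw_byWitness[where f' = "\<lambda>\<tau>. {x. \<tau> x \<noteq> x}"])
    show "\<forall>B\<in>?E. {x. ?t B x \<noteq> x} = B"
    proof
      fix B assume "B \<in> ?E"
      then obtain i j where "i < j" "B = {i, j}" using E by blast
      then show "{x. ?t B x \<noteq> x} = B" using t[of i j] moved[of i j] by simp
    qed
    show "\<forall>\<tau>\<in>transpositions n. ?t {x. \<tau> x \<noteq> x} = \<tau>"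
    proof
      fix \<tau> assume "\<tau> \<in> transpositions n"
      then obtain i j where "i < j" "\<tau> = transpose i j" using T by blast
      then show "?t {x. \<tau> x \<noteq> x} = \<tau>" using t[of i j] moved[of i j] by simp
    qed
    show "?t ` ?E \<subseteq> transpositions n"
    proof
      fix \<tau> assume "\<tau> \<in> ?t ` ?E"
      then obtain B where B: "B \<in> ?E" "\<tau> = ?t B" by blast
      then obtain i j where "i < j" "B = {i, j}" "i \<in> {1..n}" "j \<in> {1..n}" using E by blast
      moreover from this have "\<tau> = transpose i j" using B t by simp
      ultimately show "\<tau> \<in> transpositions n" unfolding transpositions_def by blast
    qed
    show "(\<lambda>\<tau>. {x. \<tau> x \<noteq> x}) ` transpositions n \<subseteq> ?E"
    proof
      fix B assume "B \<in> (\<lambda>\<tau>. {x. \<tau> x \<noteq> x}) ` transpositions n"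
      then obtain i j where "i < j" "B = {x. transpose i j x \<noteq> x}" "i \<in> {1..n}" "j \<in> {1..n}"
        using T by blast
      then show "B \<in> ?E" using moved[of i j] by simp
    qed
  qed
  then have "(\<Sum>\<tau>\<in>transpositions n. contraction q (cycle_partition n \<tau>) (basis_elt n \<alpha>))
      = (\<Sum>B\<in>?E. contraction q (cycle_partition n (?t B)) (basis_elt n \<alpha>))"
    by (rule sum.reindex_bij_betw[symmetric])
  also have "\<dots> = (\<Sum>B\<in>?E. contraction q {B} (basis_elt n \<alpha>))"
  proof (intro sum.cong refl)
    fix B assume B: "B \<in> ?E"
    then obtain i j where ij: "i < j" "B = {i, j}" "i \<in> {1..n}" "j \<in> {1..n}" using E by blast
    then have "pairs (cycle_partition n (?t B)) = {B}"
      using pairs_cycle_partition_transpose[of i n j] t[of i j] by simp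
    moreover have "pairs {B} = {B}" using B by (auto simp: pairs_def)
    ultimately have "pairs (cycle_partition n (?t B)) = pairs {B}" by simp
    from contraction_cong[OF this] show "contraction q (cycle_partition n (?t B)) (basis_elt n \<alpha>)
        = contraction q {B} (basis_elt n \<alpha>)" by simp
  qed
  finally show ?thesis by (simp add: lap_def basis_elt_def)
qed

lemma contraction_series_lap: "contraction_series q (\<lambda>k. if k = 1 then 1 else 0) (lap q)"
proof -
  have "lap q (basis_elt n \<alpha>) =
      (\<Sum>M\<in>matchings {1..n}. scale (if card M = 1 then 1 else 0) (contraction q M (basis_elt n \<alpha>)))" for n \<alpha>
  proof -
    let ?E = "{B. B \<subseteq> {1..n} \<and> card B = 2}"
    have "(\<Sum>M\<in>matchings {1..n}. scale (if card M = 1 then 1 else 0) (contraction q M (basis_elt n \<alpha>)))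
      = (\<Sum>M\<in>(\<lambda>B. {B}) ` ?E. scale (if card M = 1 then 1 else 0) (contraction q M (basis_elt n \<alpha>)))"
    proof (intro sum.mono_neutral_right ballI)
      show "finite (matchings {1..n})" by (simp add: finite_matchings)
      show "(\<lambda>B. {B}) ` ?E \<subseteq> matchings {1..n}" by (auto simp: matchings_def)
      fix M assume M: "M \<in> matchings {1..n} - (\<lambda>B. {B}) ` ?E"
      have "card M \<noteq> 1"
      proof
        assume "card M = 1"
        then obtain B where "M = {B}" by (auto simp: card_1_singleton_iff)
        then show False using M by (auto simp: matchings_def)
      qed
      then show "scale (if card M = 1 then 1 else 0) (contraction q M (basis_elt n \<alpha>)) = 0" by simp
    qed
    also have "\<dots> = (\<Sum>B\<in>?E. contraction q {B} (basis_elt n \<alpha>))"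
      by (subst sum.reindex) (auto simp: inj_on_def)
    finally show ?thesis by (simp add: lap_basis_elt)
  qed
  then show ?thesis unfolding contraction_series_def using linear_lap by blast
qed

text \<open>As \<open>0 ^ 0 = 1\<close>, only the empty matching contributes: the series with
  coefficients \<open>0 ^ k\<close> is the identity.\<close>

lemma sum_scale_0_power_card:
  assumes "\<alpha> permutes {0..n}"
  shows "(\<Sum>M\<in>matchings {1..n}. scale (0 ^ card M) (contraction q M (basis_elt n \<alpha>))) = basis_elt n \<alpha>"
proof -
  have "(\<Sum>M\<in>matchings {1..n}. scale (0 ^ card M) (contraction q M (basis_elt n \<alpha>)))
    = (\<Sum>M\<in>{{}}. scale (0 ^ card M) (contraction q M (basis_elt n \<alpha>)))"
  proof (rule sum.mono_neutral_right)
    show "{{}} \<subseteq> matchings {1..n}" by (simp add: matchings_def)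
    show "\<forall>M\<in>matchings {1..n} - {{}}. scale (0 ^ card M) (contraction q M (basis_elt n \<alpha>)) = 0"
      using finite_matching[of "{1..n}"] by (auto simp: card_gt_0_iff zero_power)
  qed (simp add: finite_matchings)
  then show ?thesis using contraction_empty[OF assms] by simp
qed

text \<open>A matching with l pairs can be contracted pair by pair in l! orders.\<close>

lemma contraction_series_lap_power:
  assumes "q \<noteq> 0"
  shows "contraction_series q (\<lambda>k. if k = l then fact l else 0) (lap q ^^ l)"
proof (induction l)
  case 0
  have zero: "(if k = 0 then fact 0 else 0) = (0 ^ k :: complex)" for k :: nat by (auto simp: zero_power)
  show ?case
    unfolding contraction_series_def zero using linear_lap_power[where l = 0] sum_scale_0_power_card by simp
next
  case (Suc l)
  have "(\<Sum>j\<le>k. of_nat (k choose j) * ((if j = l then fact l else 0) * (if k - j = 1 then 1 else 0)))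
      = (if k = Suc l then fact (Suc l) else (0::complex))" for k
  proof -
    have "(\<Sum>j\<le>k. of_nat (k choose j) * ((if j = l then fact l else 0) * (if k - j = 1 then 1 else 0)))
        = (\<Sum>j\<le>k. if j = l then of_nat (k choose l) * (fact l * (if k - l = 1 then 1 else (0::complex))) else 0)"
      by (intro sum.cong) auto
    also have "\<dots> = (if k = Suc l then fact (Suc l) else 0)"
      by (auto simp: Suc_diff_le)
    finally show ?thesis .
  qed
  then show ?case
    using contraction_series_compose[OF Suc contraction_series_lap assms] by (simp add: o_def)
qed

lemma contraction_series_exp_lap:
  assumes "q \<noteq> 0"
  shows "contraction_series q (\<lambda>k. t ^ k) (exp_lap q t)"
proof -
  have "exp_lap q t (basis_elt n \<alpha>) = (\<Sum>M\<in>matchings {1..n}. scale (t ^ card M) (contraction q M (basis_elt n \<alpha>)))"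
    if \<alpha>: "\<alpha> permutes {0..n}" for n \<alpha>
  proof -
    let ?C = "\<lambda>M. contraction q M (basis_elt n \<alpha>)"
    let ?K = "{l. (lap q ^^ l) (basis_elt n \<alpha>) \<noteq> 0} \<union> card ` matchings {1..n}"
    have K: "finite ?K" using finite_lap_powers finite_matchings[of "{1..n}"] by simp
    have "exp_lap q t (basis_elt n \<alpha>)
        = (\<Sum>l\<in>?K. scale (t ^ l / fact l) ((lap q ^^ l) (basis_elt n \<alpha>)))"
      using K by (rule exp_lap_eq_sum) blast
    also have "\<dots> = (\<Sum>l\<in>?K. \<Sum>M\<in>matchings {1..n}. if l = card M then scale (t ^ card M) (?C M) else 0)"
    proof (rule sum.cong)
      fix l
      have "(lap q ^^ l) (basis_elt n \<alpha>) = (\<Sum>M\<in>matchings {1..n}. scale (if card M = l then fact l else 0) (?C M))"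
        using contraction_series_lap_power[OF assms, of l] \<alpha> unfolding contraction_series_def by blast
      then show "scale (t ^ l / fact l) ((lap q ^^ l) (basis_elt n \<alpha>))
          = (\<Sum>M\<in>matchings {1..n}. if l = card M then scale (t ^ card M) (?C M) else 0)"
        by (auto simp: free.scale_sum_right intro!: sum.cong)
    qed simp
    also have "\<dots> = (\<Sum>M\<in>matchings {1..n}. \<Sum>l\<in>?K. if l = card M then scale (t ^ card M) (?C M) else 0)"
      by (rule sum.swap)
    also have "\<dots> = (\<Sum>M\<in>matchings {1..n}. scale (t ^ card M) (?C M))"
      using K by (intro sum.cong) (auto simp: sum.delta)
    finally show ?thesis .
  qed
  then show ?thesis unfolding contraction_series_def using linear_exp_lap by blast
qed

lemma contraction_series_wick: "q \<noteq> 0 \<Longrightarrow> contraction_series q (\<lambda>k. (-1) ^ k) (wick q)"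
  using contraction_series_exp_lap[of q "-1"] unfolding wick_def algT_def by simp

lemma group_alg_basis:
  "\<eta> \<in> group_alg n \<Longrightarrow> b \<in> Poly_Mapping.keys \<eta> \<Longrightarrow> \<exists>\<alpha>. \<alpha> permutes {0..n} \<and> Poly_Mapping.single b 1 = basis_elt n \<alpha>"
  unfolding group_alg_def basis_elt_def by auto

text \<open>By the binomial theorem, the coefficients of the composition are \<open>(1 - 1) ^ k =
  0 ^ k\<close>.\<close>

lemma wick_exp_lap:
  assumes "q \<noteq> 0" "\<eta> \<in> group_alg n"
  shows "wick q (exp_lap q 1 \<eta>) = \<eta>"
proof (rule linear_eqI[of "\<lambda>x. wick q (exp_lap q 1 x)" "\<lambda>x. x"])
  show "linear_op (\<lambda>x. wick q (exp_lap q 1 x))"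
    by (rule linear_op_compose[OF linear_exp_lap linear_wick])
  show "linear_op (\<lambda>x. x)" by (rule linear_opI) simp_all
  fix b assume "b \<in> Poly_Mapping.keys \<eta>"
  then obtain \<alpha> where \<alpha>: "\<alpha> permutes {0..n}" "Poly_Mapping.single b 1 = basis_elt n \<alpha>"
    using group_alg_basis[OF assms(2)] by blast
  have binom: "(\<Sum>j\<le>k. of_nat (k choose j) * (1 ^ j * (-1) ^ (k - j))) = (0 ^ k :: complex)" for k
    using binomial_ring[of "1::complex" "-1" k] by (simp add: mult.assoc)
  have "wick q (exp_lap q 1 (basis_elt n \<alpha>))
      = (\<Sum>M\<in>matchings {1..n}. scale (0 ^ card M) (contraction q M (basis_elt n \<alpha>)))"
    using contraction_series_compose[OF contraction_series_exp_lap[OF assms(1), of 1]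
        contraction_series_wick[OF assms(1)] assms(1)] \<alpha>(1)
    unfolding contraction_series_def binom by blast
  then show "wick q (exp_lap q 1 (Poly_Mapping.single b 1)) = Poly_Mapping.single b 1"
    using sum_scale_0_power_card[OF \<alpha>(1)] \<alpha>(2) by simp
qed

section \<open>Partitions with blocks of size one and two as matchings\<close>

text \<open>The partition is recovered by adding the uncovered points as singletons.\<close>

lemma bij_betw_pairs: "bij_betw pairs (P12 n) (matchings {1..n})"
proof (rule bij_betw_byWitness[where f' = "\<lambda>M. M \<union> (\<lambda>x. {x}) ` ({1..n} - \<Union>M)"])
  show "\<forall>\<pi>\<in>P12 n. pairs \<pi> \<union> (\<lambda>x. {x}) ` ({1..n} - \<Union>(pairs \<pi>)) = \<pi>"
  proof
    fix \<pi> assume "\<pi> \<in> P12 n"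
    then have U: "\<Union>\<pi> = {1..n}" and disj: "disjoint \<pi>" and card: "\<And>B. B \<in> \<pi> \<Longrightarrow> card B = 1 \<or> card B = 2"
      unfolding P12_def partition_on_def by auto
    show "pairs \<pi> \<union> (\<lambda>x. {x}) ` ({1..n} - \<Union>(pairs \<pi>)) = \<pi>"
    proof (intro equalityI subsetI)
      fix B assume "B \<in> pairs \<pi> \<union> (\<lambda>x. {x}) ` ({1..n} - \<Union>(pairs \<pi>))"
      then consider "B \<in> pairs \<pi>" | x where "B = {x}" "x \<in> {1..n}" "x \<notin> \<Union>(pairs \<pi>)" by blast
      then show "B \<in> \<pi>"
      proof cases
        case 2
        then obtain C where C: "C \<in> \<pi>" "x \<in> C" using U by blast
        then have "card C = 1" using 2(3) card[OF C(1)] unfolding pairs_def by blast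
        then have "C = {x}" using C(2) by (auto simp: card_1_singleton_iff)
        then show ?thesis using C 2 by simp
      qed (simp add: pairs_def)
    next
      fix B assume B: "B \<in> \<pi>"
      show "B \<in> pairs \<pi> \<union> (\<lambda>x. {x}) ` ({1..n} - \<Union>(pairs \<pi>))"
      proof (cases "card B = 2")
        case False
        then have "card B = 1" using card[OF B] by blast
        then obtain x where x: "B = {x}" by (auto simp: card_1_singleton_iff)
        have "x \<notin> C" if "C \<in> pairs \<pi>" for C
        proof -
          have "C \<in> \<pi>" "C \<noteq> B" using that False unfolding pairs_def by auto
          then show ?thesis using disjointD[OF disj, of C B] B x by auto
        qed
        moreover have "x \<in> {1..n}" using B U x by blast
        ultimately show ?thesis using x by blast
      qed (simp add: B pairs_def)
    qed
  qed
  show "\<forall>M\<in>matchings {1..n}. pairs (M \<union> (\<lambda>x. {x}) ` ({1..n} - \<Union>M)) = M"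
    unfolding pairs_def matchings_def by auto
  show "pairs ` P12 n \<subseteq> matchings {1..n}"
  proof
    fix M assume "M \<in> pairs ` P12 n"
    then obtain \<pi> where \<pi>: "partition_on {1..n} \<pi>" "M = pairs \<pi>" unfolding P12_def by blast
    then have "disjoint M" unfolding partition_on_def pairs_def by (auto intro: pairwise_subset)
    then show "M \<in> matchings {1..n}"
      using \<pi> unfolding matchings_def partition_on_def pairs_def by auto
  qed
  show "(\<lambda>M. M \<union> (\<lambda>x. {x}) ` ({1..n} - \<Union>M)) ` matchings {1..n} \<subseteq> P12 n"
  proof
    fix \<pi> assume "\<pi> \<in> (\<lambda>M. M \<union> (\<lambda>x. {x}) ` ({1..n} - \<Union>M)) ` matchings {1..n}"
    then obtain M where M: "M \<in> matchings {1..n}" and \<pi>: "\<pi> = M \<union> (\<lambda>x. {x}) ` ({1..n} - \<Union>M)" by blast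
    have U: "\<Union>\<pi> = {1..n}" using matchings_Union[OF M] unfolding \<pi> by auto
    have card: "card B = 1 \<or> card B = 2" if "B \<in> \<pi>" for B
      using M that unfolding \<pi> matchings_def by auto
    have "disjoint \<pi>"
      unfolding \<pi>
    proof (rule disjoint_union)
      show "disjoint M" using M unfolding matchings_def by simp
      show "disjoint ((\<lambda>x. {x}) ` ({1..n} - \<Union>M))" unfolding disjoint_def by auto
      show "\<Union>M \<inter> \<Union>((\<lambda>x. {x}) ` ({1..n} - \<Union>M)) = {}" by auto
    qed
    moreover have "{} \<notin> \<pi>" using card by force
    ultimately show "\<pi> \<in> P12 n" using U card unfolding P12_def partition_on_def by blast
  qed
qed

lemma contraction_pairs: "contraction q \<pi> = contraction q (pairs \<pi>)"
  by (rule contraction_cong) (auto simp: pairs_def)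

definition crossing :: "nat \<Rightarrow> nat set set" where
  "crossing n = {{i, j} | i j. i \<le> n \<and> n < j}"

lemma crossing_iff: "(\<forall>i j. {i, j} \<in> M \<and> i < j \<longrightarrow> i \<le> n \<and> n < j) \<longleftrightarrow> M \<subseteq> crossing n"
  if two: "\<forall>B\<in>M. card B = 2"
proof (intro iffI allI impI subsetI)
  fix B assume M: "\<forall>i j. {i, j} \<in> M \<and> i < j \<longrightarrow> i \<le> n \<and> n < j" and B: "B \<in> M"
  then have "card B = 2" using two by blast
  then obtain i j where ij: "i < j" "B = {i, j}" by (rule two_element_set)
  then show "B \<in> crossing n"
    using M B unfolding crossing_def by blast
next
  fix i j assume M: "M \<subseteq> crossing n" and ij: "{i, j} \<in> M \<and> i < j"
  then obtain i' j' where "{i, j} = {i', j'}" "i' \<le> n" "n < j'" unfolding crossing_def by blast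
  then show "i \<le> n \<and> n < j" using ij by (auto simp: doubleton_eq_iff)
qed

lemma bij_betw_Collect:
  assumes "bij_betw f A B"
  shows "bij_betw f {a \<in> A. P (f a)} {b \<in> B. P b}"
proof (rule bij_betw_imageI)
  show "inj_on f {a \<in> A. P (f a)}"
    by (rule inj_on_subset[OF bij_betw_imp_inj_on[OF assms]]) simp
  show "f ` {a \<in> A. P (f a)} = {b \<in> B. P b}"
    unfolding bij_betw_imp_surj_on[OF assms, symmetric] by blast
qed

lemma bij_betw_pairs_between:
  "bij_betw pairs (P12_between n k) {M \<in> matchings {1..n + k}. M \<subseteq> crossing n}"
proof -
  have *: "P12_between n k = {\<pi> \<in> P12 (n + k). pairs \<pi> \<subseteq> crossing n}"
    unfolding P12_between_def by (intro Collect_cong conj_cong refl crossing_iff) (simp add: pairs_def)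
  show ?thesis unfolding * by (rule bij_betw_Collect[OF bij_betw_pairs])
qed


section \<open>Products\<close>

definition shift :: "nat \<Rightarrow> nat \<Rightarrow> nat" where
  "shift n j = (if j = 0 then 0 else n + j)"

lemma perm_union_eq: "perm_union n k \<alpha> \<beta> = map_permutation {0..k} (shift n) \<beta> \<circ> \<alpha>"
  unfolding perm_union_def shift_def by simp

lemma shift_less: "i < j \<Longrightarrow> shift n i < shift n j"
  by (simp add: shift_def)

lemma inj_on_shift: "inj_on (shift n) S"
  by (auto simp: inj_on_def shift_def split: if_splits)

lemma shift_image: "shift n ` {1..k} = {n + 1..n + k}"
proof -
  have "shift n ` {1..k} = (+) n ` {1..k}" by (intro image_cong) (auto simp: shift_def)
  then show ?thesis by simp
qed

lemma shift_image_0: "shift n ` {0..k} = insert 0 {n + 1..n + k}"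
proof -
  have "{0..k} = insert 0 {1..k}" by auto
  then show ?thesis by (simp only: image_insert shift_image) (simp add: shift_def)
qed

text \<open>All nonzero points of Y come after the points of X, so the joint ranks are those of X
  followed by the shifted ones of Y. This is exactly the shift in the definition of
  \<open>\<alpha> \<union> \<beta>\<close>; both sets contain 0, hence the subtracted
  ones.\<close>

lemma relabel_concat:
  assumes X: "finite X" "0 \<in> X" and Y: "finite Y" "0 \<in> Y"
    and XY: "\<And>x y. x \<in> X \<Longrightarrow> y \<in> Y - {0} \<Longrightarrow> x < y"
    and a: "a permutes X" and b: "b permutes Y"
  shows "perm_union (card X - 1) (card Y - 1) (relabel X a) (relabel Y b) = relabel (X \<union> Y) (b \<circ> a)"
    and "card X - 1 + (card Y - 1) = card (X \<union> Y) - 1"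
proof -
  let ?Z = "X \<union> Y" and ?s = "shift (card X - 1)"
  have "x \<notin> Y - {0}" if "x \<in> X" for x using XY[OF that, of x] by (metis less_irrefl)
  then have int: "X \<inter> (Y - {0}) = {}" by blast
  have Z: "?Z = X \<union> (Y - {0})" using X(2) by blast
  have pos: "card X > 0" "card Y > 0" using X Y by (auto simp: card_gt_0_iff)
  have r: "inj_on (rank ?Z) ?Z" using X(1) Y(1) by (intro inj_on_rank) simp
  have rX: "inj_on (rank ?Z) X" and rY: "inj_on (rank ?Z) Y" by (rule inj_on_subset[OF r], simp)+
  have "card ?Z = card X + card (Y - {0})" unfolding Z using X(1) Y(1) int by (intro card_Un_disjoint) auto
  then show "card X - 1 + (card Y - 1) = card ?Z - 1" using pos Y by simp
  have rank_X: "rank ?Z x = rank X x" if "x \<in> X" for x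
  proof -
    have "\<not> y < x" if "y \<in> Y - {0}" for y using XY[OF \<open>x \<in> X\<close> that] by simp
    then have "{y \<in> ?Z. y < x} = {y \<in> X. y < x}" unfolding Z by blast
    then show ?thesis by (simp add: rank_def)
  qed
  have rank_Y: "rank ?Z y = ?s (rank Y y)" if y: "y \<in> Y" for y
  proof (cases "y = 0")
    case False
    have "x < y" if "x \<in> X" for x using XY[OF that, of y] y False by simp
    then have "{z \<in> ?Z. z < y} = X \<union> ({z \<in> Y. z < y} - {0})" using X(2) by blast
    moreover have "X \<inter> ({z \<in> Y. z < y} - {0}) = {}" using int by blast
    ultimately have "rank ?Z y = card X + card ({z \<in> Y. z < y} - {0})"
      unfolding rank_def using X(1) Y(1) by (simp add: card_Un_disjoint)
    also have "card ({z \<in> Y. z < y} - {0}) = rank Y y - 1"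
      unfolding rank_def using False Y by (subst card_Diff_singleton) auto
    finally have "rank ?Z y = card X + (rank Y y - 1)" .
    moreover have "rank Y y > 0" using rank_less[OF Y, of y] False by simp
    ultimately show ?thesis using pos by (simp add: shift_def)
  qed (simp add: shift_def)
  have "relabel ?Z (b \<circ> a) = map_permutation ?Z (rank ?Z) b \<circ> map_permutation ?Z (rank ?Z) a"
    unfolding relabel_eq using permutes_subset[OF a] r by (intro map_permutation_compose') auto
  moreover have "map_permutation ?Z (rank ?Z) a = map_permutation X (rank ?Z) a"
    using a r by (intro map_permutation_superset) auto
  moreover have "map_permutation X (rank ?Z) a = relabel X a"
    unfolding relabel_eq using rX a rank_X by (intro map_permutation_cong) auto
  moreover have "map_permutation ?Z (rank ?Z) b = map_permutation Y (rank ?Z) b"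
    using b r by (intro map_permutation_superset) auto
  moreover have "map_permutation Y (rank ?Z) b = map_permutation Y (?s \<circ> rank Y) b"
    using rY b rank_Y by (intro map_permutation_cong) auto
  moreover have "map_permutation Y (?s \<circ> rank Y) b = map_permutation {0..card Y - 1} ?s (relabel Y b)"
    unfolding relabel_eq using inj_on_rank[OF Y(1)] rank_image[OF Y] inj_on_shift
    by (intro map_permutation_compose[symmetric]) (auto simp: bij_betw_def)
  ultimately show "perm_union (card X - 1) (card Y - 1) (relabel X a) (relabel Y b) = relabel ?Z (b \<circ> a)"
    by (simp add: perm_union_eq)
qed

lemma star_vec:
  assumes "finite X" "0 \<in> X" "finite Y" "0 \<in> Y"
    and "\<And>x y. x \<in> X \<Longrightarrow> y \<in> Y - {0} \<Longrightarrow> x < y"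
    and "a permutes X" "b permutes Y"
  shows "vec X a \<star> vec Y b = vec (X \<union> Y) (b \<circ> a)"
proof -
  note concat = relabel_concat[OF assms(1-4) _ assms(6,7)]
  show ?thesis
    using concat(1) concat(2) assms(5) by (simp add: vec_def star_basis)
qed

lemma comp_commute_disjoint:
  assumes "f permutes A" "g permutes B" "A \<inter> B = {}"
  shows "f \<circ> g = g \<circ> f"
proof
  fix x
  have "f x \<in> A" if "x \<in> A" using permutes_in_image[OF assms(1)] that by blast
  moreover have "g x \<in> B" if "x \<in> B" using permutes_in_image[OF assms(2)] that by blast
  ultimately show "(f \<circ> g) x = (g \<circ> f) x"
    using permutes_not_in[OF assms(1)] permutes_not_in[OF assms(2)] assms(3)
    by (cases "x \<in> A"; cases "x \<in> B") (auto simp: disjoint_iff)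
qed

text \<open>First M is removed, which does not see b; then N is removed from \<open>b \<circ>
  reduced M a\<close>, which does not see the right factor. So the two-step formula for \<open>M
  \<union> N\<close> splits into the two separate contractions, although the cycles of a and b
  through 0 are merged in \<open>b \<circ> a\<close>.\<close>

lemma reduced_concat:
  assumes X: "finite X" "a permutes X" and Y: "finite Y" "b permutes Y" and XY: "X \<inter> Y = {0}"
    and M: "M \<in> matchings (X - {0})" and N: "N \<in> matchings (Y - {0})"
  shows "M \<union> N \<in> matchings (X \<union> Y - {0})"
    and "reduced (M \<union> N) (b \<circ> a) = reduced N b \<circ> reduced M a"
    and "q \<noteq> 0 \<Longrightarrow> weight q (M \<union> N) (b \<circ> a) = weight q M a * weight q N b"
proof -
  let ?Z = "X \<union> Y"
  have MU: "\<Union>M \<subseteq> X - {0}" and NU: "\<Union>N \<subseteq> Y - {0}" using matchings_Union M N by auto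
  have disj: "Y \<inter> \<Union>M = {}" "(X - \<Union>M) \<inter> \<Union>N = {}" "\<Union>M \<inter> Y = {}" using MU NU XY by auto
  have MZ: "M \<in> matchings (?Z - {0})" using M matchings_mono[of "X - {0}" "?Z - {0}"] by auto
  have NZ: "N \<in> matchings (?Z - {0} - \<Union>M)"
    using N matchings_mono[of "Y - {0}" "?Z - {0} - \<Union>M"] disj by auto
  have MN: "M \<inter> N = {}" using matching_disjoint[OF NZ] .
  show MNZ: "M \<union> N \<in> matchings (?Z - {0})" using matchings_Un_iff[OF MN] MZ NZ by blast
  have ba: "b \<circ> a permutes ?Z"
    using X Y by (intro permutes_compose) (auto intro: permutes_subset)
  have Ma: "involution M \<circ> a permutes X" using involution_comp_permutes[OF X(2) M] .
  have Nb: "involution N \<circ> b permutes Y" using involution_comp_permutes[OF Y(2) N] .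
  have comm: "involution M \<circ> (b \<circ> a) = b \<circ> (involution M \<circ> a)"
    using comp_commute_disjoint[OF involution_permutes[OF M] Y(2) disj(3)] by (metis comp_assoc)
  have b_fixed: "b z = z" if "z \<in> \<Union>M" for z using permutes_not_in[OF Y(2)] that disj by blast
  have red_M: "reduced M (b \<circ> a) = b \<circ> reduced M a"
    unfolding reduced_def comm by (rule induced_perm_comp_left[OF Ma X(1) Y(2) disj(1)])
  have weight_M: "weight q M (b \<circ> a) = weight q M a" for q
    unfolding weight_def comm
    by (subst inner_orbits_comp_left) (use b_fixed permutes_inj[OF Y(2)] in auto)
  have red_a: "reduced M a permutes X - \<Union>M" using reduced_permutes X M by blast
  have a_fixed: "reduced M a z = z" if "z \<in> \<Union>N" for z
    using permutes_not_in[OF red_a] that disj by blast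
  have assoc: "involution N \<circ> (b \<circ> reduced M a) = (involution N \<circ> b) \<circ> reduced M a" by (simp add: comp_assoc)
  have red_N: "reduced N (b \<circ> reduced M a) = reduced N b \<circ> reduced M a"
    unfolding reduced_def[of N] assoc by (rule induced_perm_comp_right[OF Nb Y(1) red_a disj(2)])
  have weight_N: "weight q N (b \<circ> reduced M a) = weight q N b" for q
    unfolding weight_def assoc by (subst inner_orbits_comp_right) (use a_fixed in auto)
  have Z: "finite ?Z" using X Y by simp
  show "reduced (M \<union> N) (b \<circ> a) = reduced N b \<circ> reduced M a"
    using reduced_Un(1)[OF ba Z MNZ MN] by (simp add: red_M red_N)
  show "weight q (M \<union> N) (b \<circ> a) = weight q M a * weight q N b" if "q \<noteq> 0"
    using reduced_Un(2)[OF ba Z MNZ MN that] by (simp add: red_M weight_M weight_N)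
qed

text \<open>The second factor is moved to the points n+1, ..., n+k (and 0) first, which does not
  change its contraction; then the two contractions take place side by side.\<close>

lemma contraction_star:
  assumes q: "q \<noteq> 0" and \<alpha>: "\<alpha> permutes {0..n}" and \<beta>: "\<beta> permutes {0..k}"
    and M: "M \<in> matchings {1..n}" and N: "N \<in> matchings {1..k}"
  shows "contraction q M (basis_elt n \<alpha>) \<star> contraction q N (basis_elt k \<beta>)
    = contraction q (M \<union> (`) (shift n) ` N) (basis_elt (n + k) (perm_union n k \<alpha> \<beta>))"
    and "perm_union n k \<alpha> \<beta> permutes {0..n + k}"
proof -
  let ?X = "{0..n}" and ?Y = "shift n ` {0..k}" and ?N = "(`) (shift n) ` N"
  let ?b = "map_permutation {0..k} (shift n) \<beta>"
  have X: "finite ?X" and Y: "finite ?Y" by simp_all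
  have b: "?b permutes ?Y" using map_permutes[OF inj_on_shift \<beta>] by simp
  have XY: "?X \<inter> ?Y = {0}" and Z: "?X \<union> ?Y = {0..n + k}" unfolding shift_image_0 by auto
  have X0: "?X - {0} = {1..n}" and K0: "{0..k} - {0} = {1..k}" and Z0: "{0..n + k} - {0} = {1..n + k}" by auto
  have Y0: "?Y - {0} = shift n ` {1..k}" unfolding shift_image_0 shift_image by auto
  have M': "M \<in> matchings (?X - {0})" and N0: "N \<in> matchings ({0..k} - {0})" using M N X0 K0 by auto
  have N': "?N \<in> matchings (?Y - {0})" using image_matching[OF N inj_on_shift] Y0 by simp
  show pu: "perm_union n k \<alpha> \<beta> permutes {0..n + k}"
    unfolding perm_union_eq Z[symmetric] using \<alpha> b
    by (intro permutes_compose) (auto intro: permutes_subset)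
  note concat = reduced_concat[OF X \<alpha> Y b XY M' N']
  have MN: "M \<union> ?N \<in> matchings {1..n + k}" using concat(1) unfolding Z Z0 .
  have NU: "\<Union>?N = shift n ` \<Union>N" by (simp add: image_Union)
  have red_N: "reduced N \<beta> permutes {0..k} - \<Union>N" using reduced_permutes[OF \<beta> _ N0] by simp
  have red_N': "reduced ?N ?b permutes ?Y - \<Union>?N" using reduced_permutes[OF b Y N'] .
  have red_M: "reduced M \<alpha> permutes ?X - \<Union>M" using reduced_permutes[OF \<alpha> X M'] .
  have MU: "\<Union>M \<subseteq> {1..n}" and NU': "\<Union>?N \<subseteq> {n + 1..n + k}"
    using matchings_Union[OF M] matchings_Union[OF N'] unfolding Y0 shift_image by auto
  have "vec (shift n ` ({0..k} - \<Union>N)) (map_permutation ({0..k} - \<Union>N) (shift n) (reduced N \<beta>))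
      = vec ({0..k} - \<Union>N) (reduced N \<beta>)"
    by (rule vec_map_permutation[OF _ _ red_N]) (simp_all add: shift_less)
  moreover have "map_permutation ({0..k} - \<Union>N) (shift n) (reduced N \<beta>) = reduced ?N ?b"
    using map_permutation_superset[OF red_N _ inj_on_shift, of "{0..k}" n]
      reduced_image[OF inj_on_shift \<beta> _ N0, of n] by simp
  moreover have "shift n ` ({0..k} - \<Union>N) = ?Y - \<Union>?N"
    unfolding NU by (rule image_set_diff[OF inj_on_shift])
  ultimately have vec_N: "vec ({0..k} - \<Union>N) (reduced N \<beta>) = vec (?Y - \<Union>?N) (reduced ?N ?b)" by simp
  have weight_N: "weight q N \<beta> = weight q ?N ?b"
    using weight_image[OF inj_on_shift \<beta> _ N0, of q n] by simp
  have "vec (?X - \<Union>M) (reduced M \<alpha>) \<star> vec (?Y - \<Union>?N) (reduced ?N ?b)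
      = vec ((?X - \<Union>M) \<union> (?Y - \<Union>?N)) (reduced ?N ?b \<circ> reduced M \<alpha>)"
  proof (rule star_vec[OF _ _ _ _ _ red_M red_N'])
    show "0 \<in> ?X - \<Union>M" using MU by auto
    have "0 \<notin> {n + 1..n + k}" by simp
    then have "0 \<notin> \<Union>?N" using NU' by (meson subsetD)
    then show "0 \<in> ?Y - \<Union>?N" unfolding shift_image_0 by simp
    show "x < y" if "x \<in> ?X - \<Union>M" "y \<in> ?Y - \<Union>?N - {0}" for x y
      using that unfolding shift_image_0 by auto
  qed simp_all
  moreover have "({0..n} - L) \<union> (insert 0 {n + 1..n + k} - R) = {0..n + k} - (L \<union> R)"
    if "L \<subseteq> {1..n}" "R \<subseteq> {n + 1..n + k}" for L R
    using that by auto
  from this[OF MU NU'] have "(?X - \<Union>M) \<union> (?Y - \<Union>?N) = {0..n + k} - \<Union>(M \<union> ?N)"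
    unfolding shift_image_0 Union_Un_distrib .
  ultimately show "contraction q M (basis_elt n \<alpha>) \<star> contraction q N (basis_elt k \<beta>)
    = contraction q (M \<union> ?N) (basis_elt (n + k) (perm_union n k \<alpha> \<beta>))"
    unfolding contraction_basis_elt[OF \<alpha> M] contraction_basis_elt[OF \<beta> N] contraction_basis_elt[OF pu MN]
    unfolding perm_union_eq concat(2) concat(3)[OF q] vec_N weight_N
    by (simp add: module_hom.scale[OF linear_star_left] module_hom.scale[OF linear_star_right] mult.commute)
qed

text \<open>A pair that does not cross lies on one side, so the power sets of the two sides
  separate the matching into its parts.\<close>

lemma bij_betw_noncrossing:
  "bij_betw (\<lambda>(M, N). M \<union> N) (matchings {1..n} \<times> matchings {n + 1..n + k})
     {\<Theta> \<in> matchings {1..n + k}. \<Theta> \<inter> crossing n = {}}"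
proof (rule bij_betw_byWitness[where f' = "\<lambda>\<Theta>. (\<Theta> \<inter> Pow {1..n}, \<Theta> \<inter> Pow {n + 1..n + k})"])
  let ?L = "{1..n}" and ?R = "{n + 1..n + k}"
  have disj: "?L \<inter> ?R = {}" and V: "{1..n + k} = ?L \<union> ?R" by auto
  have split: "B \<in> Pow ?L \<or> B \<in> Pow ?R" if \<Theta>: "\<Theta> \<in> matchings {1..n + k}" "\<Theta> \<inter> crossing n = {}" and B: "B \<in> \<Theta>" for \<Theta> B
  proof -
    have sub: "B \<subseteq> {1..n + k}" and "card B = 2" using \<Theta>(1) B unfolding matchings_def by auto
    from this(2) obtain i j where ij: "i < j" "B = {i, j}" by (rule two_element_set)
    moreover have "B \<notin> crossing n" using \<Theta>(2) B by blast
    ultimately have "\<not> (i \<le> n \<and> n < j)" unfolding crossing_def by blast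
    then show ?thesis using ij sub by auto
  qed
  have exclusive: "False" if "B \<subseteq> ?L" "B \<subseteq> ?R" "card B = 2" for B
  proof -
    have "B \<subseteq> ?L \<inter> ?R" using that(1,2) by (rule Int_greatest)
    then show False using that(3) unfolding disj by simp
  qed
  show "\<forall>p\<in>matchings ?L \<times> matchings ?R.
      ((case p of (M, N) \<Rightarrow> M \<union> N) \<inter> Pow ?L, (case p of (M, N) \<Rightarrow> M \<union> N) \<inter> Pow ?R) = p"
  proof
    fix p assume "p \<in> matchings ?L \<times> matchings ?R"
    then obtain M N where p: "p = (M, N)" "M \<in> matchings ?L" "N \<in> matchings ?R" by blast
    have M: "B \<in> Pow ?L \<and> B \<notin> Pow ?R" if "B \<in> M" for B
      using p(2) that exclusive[of B] unfolding matchings_def by auto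
    have N: "B \<in> Pow ?R \<and> B \<notin> Pow ?L" if "B \<in> N" for B
      using p(3) that exclusive[of B] unfolding matchings_def by auto
    have "(M \<union> N) \<inter> Pow ?L = M" using M N by blast
    moreover have "(M \<union> N) \<inter> Pow ?R = N" using M N by blast
    ultimately show "((case p of (M, N) \<Rightarrow> M \<union> N) \<inter> Pow ?L, (case p of (M, N) \<Rightarrow> M \<union> N) \<inter> Pow ?R) = p"
      using p by simp
  qed
  show "\<forall>\<Theta>\<in>{\<Theta> \<in> matchings {1..n + k}. \<Theta> \<inter> crossing n = {}}.
      (case (\<Theta> \<inter> Pow ?L, \<Theta> \<inter> Pow ?R) of (M, N) \<Rightarrow> M \<union> N) = \<Theta>"
    using split by auto
  show "(\<lambda>(M, N). M \<union> N) ` (matchings ?L \<times> matchings ?R) \<subseteq> {\<Theta> \<in> matchings {1..n + k}. \<Theta> \<inter> crossing n = {}}"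
  proof
    fix \<Theta> assume "\<Theta> \<in> (\<lambda>(M, N). M \<union> N) ` (matchings ?L \<times> matchings ?R)"
    then obtain M N where \<Theta>: "\<Theta> = M \<union> N" and M: "M \<in> matchings ?L" and N: "N \<in> matchings ?R" by auto
    have "?L \<subseteq> {1..n + k}" by simp
    then have "M \<in> matchings {1..n + k}" using M by (rule subsetD[OF matchings_mono])
    moreover have "?R \<subseteq> {1..n + k} - U" if "U \<subseteq> ?L" for U using that by auto
    from this[OF matchings_Union[OF M]]
    have N': "N \<in> matchings ({1..n + k} - \<Union>M)" 
      by (rule subsetD[OF matchings_mono, OF _ N])
    ultimately have "\<Theta> \<in> matchings {1..n + k}"
      using N' by (simp only: \<Theta> matchings_Un_iff[OF matching_disjoint[OF N']] simp_thms)
    moreover have "B \<notin> crossing n" if "B \<in> \<Theta>" for B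
    proof -
      have "B \<subseteq> ?L \<or> B \<subseteq> ?R" using that matchings_Union[OF M] matchings_Union[OF N] unfolding \<Theta> by (meson Sup_upper UnE subset_trans)
      moreover have "\<not> {i, j} \<subseteq> ?L \<and> \<not> {i, j} \<subseteq> ?R" if "i \<le> n" "n < j" for i j using that by simp
      ultimately show ?thesis unfolding crossing_def by blast
    qed
    ultimately show "\<Theta> \<in> {\<Theta> \<in> matchings {1..n + k}. \<Theta> \<inter> crossing n = {}}" by blast
  qed
  show "(\<lambda>\<Theta>. (\<Theta> \<inter> Pow ?L, \<Theta> \<inter> Pow ?R)) ` {\<Theta> \<in> matchings {1..n + k}. \<Theta> \<inter> crossing n = {}}
      \<subseteq> matchings ?L \<times> matchings ?R"
  proof
    fix p assume "p \<in> (\<lambda>\<Theta>. (\<Theta> \<inter> Pow ?L, \<Theta> \<inter> Pow ?R)) ` {\<Theta> \<in> matchings {1..n + k}. \<Theta> \<inter> crossing n = {}}"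
    then obtain \<Theta> where \<Theta>: "\<Theta> \<in> matchings {1..n + k}" "p = (\<Theta> \<inter> Pow ?L, \<Theta> \<inter> Pow ?R)" by blast
    have "disjoint \<Theta>" using \<Theta>(1) unfolding matchings_def by blast
    then have "disjoint (\<Theta> \<inter> T)" for T by (rule pairwise_subset) simp
    then have "\<Theta> \<inter> Pow T \<in> matchings T" for T using \<Theta>(1) unfolding matchings_def by simp
    then show "p \<in> matchings ?L \<times> matchings ?R" unfolding \<Theta>(2) by blast
  qed
qed

lemma wick_star_wick:
  assumes q: "q \<noteq> 0" and \<alpha>: "\<alpha> permutes {0..n}" and \<beta>: "\<beta> permutes {0..k}"
  shows "wick q (basis_elt n \<alpha>) \<star> wick q (basis_elt k \<beta>) =
    (\<Sum>\<Theta> | \<Theta> \<in> matchings {1..n + k} \<and> \<Theta> \<inter> crossing n = {}.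
      scale ((-1) ^ card \<Theta>) (contraction q \<Theta> (basis_elt (n + k) (perm_union n k \<alpha> \<beta>))))"
proof -
  let ?C = "\<lambda>\<Theta>. contraction q \<Theta> (basis_elt (n + k) (perm_union n k \<alpha> \<beta>))"
  let ?s = "(`) ((`) (shift n))"
  have W: "wick q (basis_elt m \<gamma>) = (\<Sum>M\<in>matchings {1..m}. scale ((-1) ^ card M) (contraction q M (basis_elt m \<gamma>)))"
    if "\<gamma> permutes {0..m}" for m \<gamma>
    using contraction_series_wick[OF q] that unfolding contraction_series_def by blast
  have "wick q (basis_elt n \<alpha>) \<star> wick q (basis_elt k \<beta>)
      = (\<Sum>M\<in>matchings {1..n}. \<Sum>N\<in>matchings {1..k}. scale ((-1) ^ card M * (-1) ^ card N) (?C (M \<union> ?s N)))"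
    unfolding W[OF \<alpha>] W[OF \<beta>]
    by (subst sum.swap, simp add: module_hom.sum[OF linear_star_left]
        module_hom.sum[OF linear_star_right] module_hom.scale[OF linear_star_left]
        module_hom.scale[OF linear_star_right] free.scale_sum_right
        contraction_star(1)[OF q \<alpha> \<beta>] mult.commute)
  also have "\<dots> = (\<Sum>M\<in>matchings {1..n}. \<Sum>N\<in>matchings {n + 1..n + k}.
      scale ((-1) ^ card M * (-1) ^ card N) (?C (M \<union> N)))"
  proof (rule sum.cong)
    fix M assume "M \<in> matchings {1..n}"
    have "(\<Sum>N\<in>matchings {1..k}. scale ((-1) ^ card M * (-1) ^ card N) (?C (M \<union> ?s N)))
      = (\<Sum>N\<in>matchings {1..k}. scale ((-1) ^ card M * (-1) ^ card (?s N)) (?C (M \<union> ?s N)))"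
    proof (rule sum.cong)
      fix N :: "nat set set"
      have "card (?s N) = card N" by (rule card_image, rule inj_on_image, rule inj_on_shift)
      then show "scale ((-1) ^ card M * (-1) ^ card N) (?C (M \<union> ?s N))
        = scale ((-1) ^ card M * (-1) ^ card (?s N)) (?C (M \<union> ?s N))" by simp
    qed simp
    also have "\<dots> = (\<Sum>N\<in>matchings {n + 1..n + k}. scale ((-1) ^ card M * (-1) ^ card N) (?C (M \<union> N)))"
      using bij_betw_matchings_image[OF inj_on_shift, of n "{1..k}"] unfolding shift_image
      by (rule sum.reindex_bij_betw)
    finally show "(\<Sum>N\<in>matchings {1..k}. scale ((-1) ^ card M * (-1) ^ card N) (?C (M \<union> ?s N)))
      = (\<Sum>N\<in>matchings {n + 1..n + k}. scale ((-1) ^ card M * (-1) ^ card N) (?C (M \<union> N)))" .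
  qed simp
  also have "\<dots> = (\<Sum>(M, N)\<in>matchings {1..n} \<times> matchings {n + 1..n + k}.
      scale ((-1) ^ card M * (-1) ^ card N) (?C (M \<union> N)))"
    by (rule sum.cartesian_product)
  also have "\<dots> = (\<Sum>p\<in>matchings {1..n} \<times> matchings {n + 1..n + k}.
      scale ((-1) ^ card (case p of (M, N) \<Rightarrow> M \<union> N)) (?C (case p of (M, N) \<Rightarrow> M \<union> N)))"
  proof (rule sum.cong)
    fix p assume "p \<in> matchings {1..n} \<times> matchings {n + 1..n + k}"
    then obtain M N where p: "p = (M, N)" and M: "M \<in> matchings {1..n}" and N: "N \<in> matchings {n + 1..n + k}" by blast
    have "{n + 1..n + k} \<subseteq> {1..n + k} - U" if "U \<subseteq> {1..n}" for U using that by auto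
    from this[OF matchings_Union[OF M]]
    have "N \<in> matchings ({1..n + k} - \<Union>M)" by (rule subsetD[OF matchings_mono, OF _ N])
    then have "M \<inter> N = {}" by (rule matching_disjoint)
    then have "card (M \<union> N) = card M + card N"
      using finite_matching[OF _ M] finite_matching[OF _ N] by (intro card_Un_disjoint) auto
    then show "(case p of (M, N) \<Rightarrow> scale ((-1) ^ card M * (-1) ^ card N) (?C (M \<union> N)))
      = scale ((-1) ^ card (case p of (M, N) \<Rightarrow> M \<union> N)) (?C (case p of (M, N) \<Rightarrow> M \<union> N))"
      by (simp add: p power_add)
  qed simp
  also have "\<dots> = (\<Sum>\<Theta> | \<Theta> \<in> matchings {1..n + k} \<and> \<Theta> \<inter> crossing n = {}. scale ((-1) ^ card \<Theta>) (?C \<Theta>))"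
    using bij_betw_noncrossing by (rule sum.reindex_bij_betw)
  finally show ?thesis .
qed

text \<open>The coefficient of \<open>\<Theta>\<close> is the alternating sum over all ways to
  choose M among the pairs of \<open>\<Theta>\<close> in A, which vanishes unless there is no such
  pair.\<close>

lemma sum_wick_contraction:
  assumes q: "q \<noteq> 0" and \<alpha>: "\<alpha> permutes {0..n}"
  shows "(\<Sum>M | M \<in> matchings {1..n} \<and> M \<subseteq> A. wick q (contraction q M (basis_elt n \<alpha>)))
    = (\<Sum>\<Theta> | \<Theta> \<in> matchings {1..n} \<and> \<Theta> \<inter> A = {}. scale ((-1) ^ card \<Theta>) (contraction q \<Theta> (basis_elt n \<alpha>)))"
proof -
  let ?C = "\<lambda>M. contraction q M (basis_elt n \<alpha>)"
  have coeff: "(\<Sum>M\<in>Pow (\<Theta> \<inter> A). (-1) ^ (card \<Theta> - card M)) = (if \<Theta> \<inter> A = {} then (-1) ^ card \<Theta> else (0::complex))"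
    if "\<Theta> \<in> matchings {1..n}" for \<Theta>
  proof -
    let ?T = "\<Theta> \<inter> A"
    have fin: "finite \<Theta>" using finite_matching[OF _ that] by simp
    have sign: "(-1) ^ (a - b) = (-1) ^ a * ((-1) ^ b * (1::complex) ^ c)" if le: "b \<le> a" for a b c :: nat
    proof -
      obtain d where "a = b + d" using le_Suc_ex[OF le] by blast
      then show ?thesis by (cases "even b") (simp_all add: power_add)
    qed
    have "(\<Sum>M\<in>Pow ?T. (-1) ^ (card \<Theta> - card M))
        = (\<Sum>M\<in>Pow ?T. (-1) ^ card \<Theta> * ((-1) ^ card M * (1::complex) ^ (card ?T - card M)))"
      by (intro sum.cong refl sign card_mono) (use fin in auto)
    also have "\<dots> = (-1) ^ card \<Theta> * (\<Sum>M\<in>Pow ?T. (-1) ^ card M * (1::complex) ^ (card ?T - card M))"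
      by (rule sum_distrib_left[symmetric])
    also have "(\<Sum>M\<in>Pow ?T. (-1) ^ card M * (1::complex) ^ (card ?T - card M))
        = (\<Sum>j\<le>card ?T. of_nat (card ?T choose j) * ((-1) ^ j * 1 ^ (card ?T - j)))"
      using fin by (intro sum_Pow_card) simp
    also have "\<dots> = 0 ^ card ?T"
      using binomial_ring[of "-1::complex" 1 "card ?T"] by (simp add: mult.assoc)
    finally have *: "(\<Sum>M\<in>Pow ?T. (-1) ^ (card \<Theta> - card M)) = (-1) ^ card \<Theta> * (0::complex) ^ card ?T" .
    have "card ?T > 0 \<longleftrightarrow> ?T \<noteq> {}" using fin by (simp add: card_gt_0_iff)
    then show ?thesis unfolding * by (cases "?T = {}") (simp_all add: zero_power)
  qed
  have "(\<Sum>M | M \<in> matchings {1..n} \<and> M \<subseteq> A. wick q (?C M))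
    = (\<Sum>\<Theta>\<in>matchings {1..n}. scale (\<Sum>M\<in>Pow (\<Theta> \<inter> A). (-1) ^ (card \<Theta> - card M)) (?C \<Theta>))"
    using sum_contraction_series[OF contraction_series_wick[OF q] q \<alpha>, where c = "\<lambda>_. 1" and A = A] by simp
  also have "\<dots> = (\<Sum>\<Theta>\<in>matchings {1..n}. if \<Theta> \<inter> A = {} then scale ((-1) ^ card \<Theta>) (?C \<Theta>) else 0)"
    by (rule sum.cong) (simp_all add: coeff del: Pow_Int_eq)
  also have "\<dots> = (\<Sum>\<Theta> | \<Theta> \<in> matchings {1..n} \<and> \<Theta> \<inter> A = {}. scale ((-1) ^ card \<Theta>) (?C \<Theta>))"
    by (rule sum.inter_filter[symmetric]) (simp add: finite_matchings)
  finally show ?thesis .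
qed

lemma sum_P12_between:
  "(\<Sum>\<pi> | \<pi> \<in> P12_between n k \<and> P (pairs \<pi>). f (contraction q \<pi>))
    = (\<Sum>M | M \<in> matchings {1..n + k} \<and> M \<subseteq> crossing n \<and> P M. f (contraction q M))"
proof -
  have "bij_betw pairs {\<pi> \<in> P12_between n k. P (pairs \<pi>)} {M \<in> {M \<in> matchings {1..n + k}. M \<subseteq> crossing n}. P M}"
    by (rule bij_betw_Collect[OF bij_betw_pairs_between])
  from sum.reindex_bij_betw[OF this, of "\<lambda>M. f (contraction q M)"]
  show ?thesis by (simp add: contraction_pairs[symmetric] conj_assoc)
qed

text \<open>Each pair uses up a point of [n], its minimum, and one of the k other points, its
  maximum. So the sum over l in the product formula may stop at \<open>min n k\<close>.\<close>

lemma card_crossing_matching: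
  assumes "M \<in> matchings {1..n + k}" "M \<subseteq> crossing n"
  shows "card M \<le> min n k"
proof -
  have disj: "disjoint M" and two: "\<And>B. B \<in> M \<Longrightarrow> B \<subseteq> {1..n + k} \<and> card B = 2"
    using assms(1) unfolding matchings_def by auto
  have mm: "Min B \<in> B \<and> Max B \<in> B \<and> Min B \<in> {1..n} \<and> Max B \<in> {n + 1..n + k}" if B: "B \<in> M" for B
  proof -
    obtain i j where "B = {i, j}" "i \<le> n" "n < j" using assms(2) B unfolding crossing_def by blast
    moreover from this have "Min B = i" "Max B = j" by auto
    ultimately show ?thesis using two[OF B] by auto
  qed
  have "inj_on Min M" "inj_on Max M"
    using mm disjointD[OF disj] by (intro inj_onI; metis disjoint_iff)+
  moreover have "Min ` M \<subseteq> {1..n}" "Max ` M \<subseteq> {n + 1..n + k}" using mm by auto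
  ultimately have "card M \<le> card {1..n}" "card M \<le> card {n + 1..n + k}"
    by (meson card_inj_on_le finite_atLeastAtMost)+
  then show ?thesis by simp
qed

theorem mainTheorem3:
  fixes q :: real
  assumes "q \<noteq> 0"
  shows "(\<forall>n. \<forall>\<eta>\<in>group_alg n.
            algT \<eta> = wick q (exp_lap q 1 \<eta>) \<and>
            wick q (exp_lap q 1 \<eta>) =
              Sum_any (\<lambda>l. scale (1 / fact l) (wick q ((lap q ^^ l) \<eta>))) \<and>
            Sum_any (\<lambda>l. scale (1 / fact l) (wick q ((lap q ^^ l) \<eta>))) =
              (\<Sum>\<pi>\<in>P12 n. wick q (contraction q \<pi> \<eta>)))
       \<and> (\<forall>n k \<alpha> \<beta>. \<alpha> permutes {0..n} \<and> \<beta> permutes {0..k} \<longrightarrow>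
            wick q (basis_elt n \<alpha>) \<star> wick q (basis_elt k \<beta>) =
              wick q (basis_elt (n + k) (perm_union n k \<alpha> \<beta>)) +
              (\<Sum>l = 1..min n k. scale (1 / fact l)
                 (wick q (lap_between q l n k (basis_elt (n + k) (perm_union n k \<alpha> \<beta>))))) \<and>
            wick q (basis_elt (n + k) (perm_union n k \<alpha> \<beta>)) +
              (\<Sum>l = 1..min n k. scale (1 / fact l)
                 (wick q (lap_between q l n k (basis_elt (n + k) (perm_union n k \<alpha> \<beta>))))) =
              (\<Sum>\<pi>\<in>P12_between n k.
                 wick q (contraction q \<pi> (basis_elt (n + k) (perm_union n k \<alpha> \<beta>)))))"
proof (intro conjI allI ballI impI)
  fix n \<eta> assume \<eta>: "\<eta> \<in> group_alg n"
  show "algT \<eta> = wick q (exp_lap q 1 \<eta>)"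
    using wick_exp_lap[OF assms \<eta>] by (simp add: algT_def)
  show series: "wick q (exp_lap q 1 \<eta>) = Sum_any (\<lambda>l. scale (1 / fact l) (wick q ((lap q ^^ l) \<eta>)))"
  proof -
    let ?K = "{l. (lap q ^^ l) \<eta> \<noteq> 0}"
    have K: "finite ?K" by (rule finite_lap_powers)
    have "wick q (exp_lap q 1 \<eta>) = (\<Sum>l\<in>?K. scale (1 / fact l) (wick q ((lap q ^^ l) \<eta>)))"
      using exp_lap_eq_sum[OF K order_refl, of 1]
      by (simp add: module_hom.sum[OF linear_wick] module_hom.scale[OF linear_wick])
    also have "\<dots> = Sum_any (\<lambda>l. scale (1 / fact l) (wick q ((lap q ^^ l) \<eta>)))"
    proof (rule Sum_any.expand_superset[OF K, symmetric])
      show "{l. scale (1 / fact l) (wick q ((lap q ^^ l) \<eta>)) \<noteq> 0} \<subseteq> ?K"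
        by (auto simp: module_hom.zero[OF linear_wick])
    qed
    finally show ?thesis .
  qed
  show "Sum_any (\<lambda>l. scale (1 / fact l) (wick q ((lap q ^^ l) \<eta>))) = (\<Sum>\<pi>\<in>P12 n. wick q (contraction q \<pi> \<eta>))"
  proof -
    have "exp_lap q 1 \<eta> = (\<Sum>M\<in>matchings {1..n}. contraction q M \<eta>)"
    proof (rule linear_eqI[of "exp_lap q 1" "\<lambda>\<eta>. \<Sum>M\<in>matchings {1..n}. contraction q M \<eta>"])
      show "linear_op (exp_lap q 1)" by (rule linear_exp_lap)
      show "linear_op (\<lambda>\<eta>. \<Sum>M\<in>matchings {1..n}. contraction q M \<eta>)"
        by (intro linear_op_sum linear_contraction)
      fix b assume "b \<in> Poly_Mapping.keys \<eta>"
      then obtain \<alpha> where "\<alpha> permutes {0..n}" "Poly_Mapping.single b 1 = basis_elt n \<alpha>"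
        using group_alg_basis[OF \<eta>] by blast
      then show "exp_lap q 1 (Poly_Mapping.single b 1)
          = (\<Sum>M\<in>matchings {1..n}. contraction q M (Poly_Mapping.single b 1))"
        using contraction_series_exp_lap[OF assms, of 1] unfolding contraction_series_def by simp
    qed
    then have "wick q (exp_lap q 1 \<eta>) = (\<Sum>M\<in>matchings {1..n}. wick q (contraction q M \<eta>))"
      by (simp add: module_hom.sum[OF linear_wick])
    also have "\<dots> = (\<Sum>\<pi>\<in>P12 n. wick q (contraction q (pairs \<pi>) \<eta>))"
      using bij_betw_pairs by (rule sum.reindex_bij_betw[symmetric])
    finally show ?thesis using series by (simp add: contraction_pairs[symmetric])
  qed
next
  fix n k :: nat and \<alpha> \<beta> assume "\<alpha> permutes {0..n} \<and> \<beta> permutes {0..k}"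
  then have \<alpha>: "\<alpha> permutes {0..n}" and \<beta>: "\<beta> permutes {0..k}" by auto
  let ?x = "basis_elt (n + k) (perm_union n k \<alpha> \<beta>)"
  let ?W = "\<lambda>M. wick q (contraction q M ?x)"
  let ?S = "{M. M \<in> matchings {1..n + k} \<and> M \<subseteq> crossing n}"
  have empty: "{} \<in> matchings V" for V by (simp add: matchings_def)
  have pu: "perm_union n k \<alpha> \<beta> permutes {0..n + k}"
    using contraction_star(2)[OF assms \<alpha> \<beta> empty empty] .
  have fin: "finite ?S" by (simp add: finite_matchings)
  have between: "(\<Sum>\<pi>\<in>P12_between n k. ?W \<pi>) = (\<Sum>M\<in>?S. ?W M)"
    using sum_P12_between[where P = "\<lambda>_. True" and f = "\<lambda>c. wick q (c ?x)"] by simp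
  have degree: "(\<Sum>M | M \<in> ?S \<and> card M = l. ?W M)
      = scale (1 / fact l) (wick q (lap_between q l n k ?x))" for l
    unfolding lap_between_def
    using sum_P12_between[where P = "\<lambda>M. card M = l" and f = "\<lambda>c. c ?x"]
    by (simp add: module_hom.sum[OF linear_wick] module_hom.scale[OF linear_wick] conj_assoc)
  \<comment> \<open>The empty matching is the term of degree zero, which the product formula lists separately.\<close>
  have "{M. M \<in> ?S \<and> card M = 0} = {{}}"
    using finite_matching[of "{1..n + k}"] empty by auto
  then have degree_0: "(\<Sum>M | M \<in> ?S \<and> card M = 0. ?W M) = wick q ?x"
    using contraction_empty[OF pu] by simp
  have "(\<Sum>M\<in>?S. ?W M) = (\<Sum>l = 0..min n k. \<Sum>M | M \<in> ?S \<and> card M = l. ?W M)"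
    using fin card_crossing_matching by (intro sum.group[symmetric]) auto
  also have "\<dots> = wick q ?x + (\<Sum>l = 1..min n k. \<Sum>M | M \<in> ?S \<and> card M = l. ?W M)"
    using degree_0 by (simp add: sum.atLeast_Suc_atMost)
  finally have split: "(\<Sum>M\<in>?S. ?W M)
      = wick q ?x + (\<Sum>l = 1..min n k. scale (1 / fact l) (wick q (lap_between q l n k ?x)))"
    unfolding degree .
  then show "wick q ?x + (\<Sum>l = 1..min n k. scale (1 / fact l) (wick q (lap_between q l n k ?x)))
      = (\<Sum>\<pi>\<in>P12_between n k. ?W \<pi>)"
    unfolding between by simp
  have "wick q (basis_elt n \<alpha>) \<star> wick q (basis_elt k \<beta>) = (\<Sum>M\<in>?S. ?W M)"
    unfolding wick_star_wick[OF assms \<alpha> \<beta>] sum_wick_contraction[OF assms pu] ..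
  then show "wick q (basis_elt n \<alpha>) \<star> wick q (basis_elt k \<beta>)
      = wick q ?x + (\<Sum>l = 1..min n k. scale (1 / fact l) (wick q (lap_between q l n k ?x)))"
    unfolding split .
qed

end
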